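(* Let $E$ be a Banach lattice with the dual positive Schur property. Then, for every Banach space $X$, the adjoint $T^* \colon X^* \longrightarrow E^*$ of every bounded order weakly compact operator $T \colon E \longrightarrow X$ is almost limited, hence $T^{**} \colon E^{**} \longrightarrow X^{**}$ is almost Dunford-Pettis.
   Context: Operators are linear. A Banach lattice $E$ has the dual positive Schur property if every positive weak$^*$-null sequence in $E^*$ is norm null. An operator $T$ from a Banach lattice $E$ to a Banach space $X$ is order weakly compact if $T([0,x])$ is relatively weakly compact in $X$ for every positive $x \in E$. An operator $S$ from a Banach space $Y$ to a Banach lattice $G$ is almost limited if $S^*$ sends disjoint weak$^*$-null sequences in $G^*$ to norm null sequences in $Y^*$. An operator from a Banach lattice to a Banach space is almost Dunford-Pettis if it sends disjoint weakly null sequences to norm null sequences (equivalently, positive disjoint weakly null sequences to norm null sequences). *)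

theory Defs
  imports "HOL-Analysis.Analysis" "HOL-Library.Lattice_Algebras"
begin

section \<open>Banach lattices\<close>

text \<open>
  All Banach spaces and Banach lattices are over the reals. The lattice operations, the order and
  the modulus are those of the type classes \<^class>\<open>lattice\<close> and \<^class>\<open>abs\<close>.
\<close>

class banach_lattice = banach + ordered_real_vector + lattice_ab_group_add_abs +
  assumes norm_mono_abs: "\<bar>x\<bar> \<le> \<bar>y\<bar> \<Longrightarrow> norm x \<le> norm y"

lemma norm_abs_eq: "norm \<bar>x\<bar> = norm (x :: 'a::banach_lattice)"
  by (intro order.antisym norm_mono_abs) simp_all

lemma norm_mono_nonneg: "0 \<le> x \<Longrightarrow> x \<le> y \<Longrightarrow> norm x \<le> norm (y :: 'a::banach_lattice)"
  by (rule norm_mono_abs) (metis abs_of_nonneg order_trans)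

instance real :: banach_lattice
  by standard simp

text \<open>
  Order complete Banach lattices whose closed unit ball is an order interval \<open>[-e, e]\<close>. The bounded
  operators from any Banach lattice into such a lattice form a Banach lattice under the operator norm.
  The only purpose of the class is to have \<^typ>\<open>real\<close> as an instance, so that the dual
  \<^typ>\<open>'a \<Rightarrow>\<^sub>L real\<close> of a Banach lattice (and hence also its bidual) is an instance of
  \<^class>\<open>banach_lattice\<close>: type class arities do not allow \<^typ>\<open>real\<close> itself as an argument.
\<close>

class unital_banach_lattice = banach_lattice + conditionally_complete_lattice +
  assumes unit_ball_interval: "\<exists>e. \<forall>x. norm x \<le> 1 \<longleftrightarrow> \<bar>x\<bar> \<le> e"

instance real :: unital_banach_lattice
  by standard auto

definition order_unit :: "'a::unital_banach_lattice"
  where "order_unit = (SOME e. \<forall>x::'a. norm x \<le> 1 \<longleftrightarrow> \<bar>x\<bar> \<le> e)"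

lemma norm_le_1_iff: "norm x \<le> 1 \<longleftrightarrow> \<bar>x\<bar> \<le> (order_unit :: 'a::unital_banach_lattice)"
  using someI_ex[OF unit_ball_interval[where 'a='a]] unfolding order_unit_def by blast

lemma order_unit_nonneg: "0 \<le> (order_unit :: 'a::unital_banach_lattice)"
  using norm_le_1_iff[of "0::'a"] by simp

lemma abs_scaleR_nonneg:
  fixes x :: "'a::banach_lattice"
  assumes "0 \<le> c"
  shows "\<bar>c *\<^sub>R x\<bar> = c *\<^sub>R \<bar>x\<bar>"
proof (cases "c = 0")
  case False
  with assms have c: "c > 0" by simp
  show ?thesis
  proof (rule order.antisym)
    have "c *\<^sub>R x \<le> c *\<^sub>R \<bar>x\<bar>"
      by (rule scaleR_left_mono[OF abs_ge_self assms])
    moreover have "- (c *\<^sub>R x) \<le> c *\<^sub>R \<bar>x\<bar>"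
      using scaleR_left_mono[OF abs_ge_minus_self[of x] assms] by simp
    ultimately show "\<bar>c *\<^sub>R x\<bar> \<le> c *\<^sub>R \<bar>x\<bar>" by (rule abs_leI)
  next
    have *: "x \<le> inverse c *\<^sub>R \<bar>c *\<^sub>R x\<bar>"
      using scaleR_left_mono[OF abs_ge_self[of "c *\<^sub>R x"], of "inverse c"] c by simp
    have **: "- x \<le> inverse c *\<^sub>R \<bar>c *\<^sub>R x\<bar>"
      using scaleR_left_mono[OF abs_ge_minus_self[of "c *\<^sub>R x"], of "inverse c"] c by simp
    have "c *\<^sub>R \<bar>x\<bar> \<le> c *\<^sub>R (inverse c *\<^sub>R \<bar>c *\<^sub>R x\<bar>)"
      by (rule scaleR_left_mono[OF abs_leI[OF * **] assms])
    then show "c *\<^sub>R \<bar>x\<bar> \<le> \<bar>c *\<^sub>R x\<bar>" using c by simp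
  qed
qed simp

lemma norm_le_iff_order_unit:
  fixes x :: "'a::unital_banach_lattice"
  assumes "0 \<le> r"
  shows "norm x \<le> r \<longleftrightarrow> \<bar>x\<bar> \<le> r *\<^sub>R order_unit"
proof (cases "r = 0")
  case False
  with assms have r: "r > 0" by simp
  have "norm x \<le> r \<longleftrightarrow> norm (inverse r *\<^sub>R x) \<le> 1"
    using r by (simp add: field_simps)
  also have "\<dots> \<longleftrightarrow> inverse r *\<^sub>R \<bar>x\<bar> \<le> order_unit"
    using r by (simp add: norm_le_1_iff abs_scaleR_nonneg del: norm_scaleR)
  also have "\<dots> \<longleftrightarrow> \<bar>x\<bar> \<le> r *\<^sub>R order_unit"
    using r by (simp add: pos_divideR_le_eq)
  finally show ?thesis .
qed (simp)


section \<open>The dual Banach lattice\<close>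

lemma blinfun_le_order_unit:
  fixes T :: "'a::real_normed_vector \<Rightarrow>\<^sub>L 'b::unital_banach_lattice"
  shows "\<bar>T x\<bar> \<le> (norm T * norm x) *\<^sub>R order_unit"
  using norm_blinfun[of T x] by (subst norm_le_iff_order_unit[symmetric]) auto

definition pos_op :: "('a::banach_lattice \<Rightarrow>\<^sub>L 'b::unital_banach_lattice) \<Rightarrow> 'a \<Rightarrow> 'b"
  where "pos_op T x = Sup (blinfun_apply T ` {0..x})"

lemma bdd_above_pos_op:
  fixes T :: "'a::banach_lattice \<Rightarrow>\<^sub>L 'b::unital_banach_lattice"
  shows "bdd_above (blinfun_apply T ` {0..x})"
proof (rule bdd_aboveI2)
  fix y assume y: "y \<in> {0..x}"
  have "T y \<le> (norm T * norm y) *\<^sub>R order_unit"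
    using blinfun_le_order_unit[of T y] abs_ge_self order_trans by blast
  also have "\<dots> \<le> (norm T * norm x) *\<^sub>R order_unit"
    using y by (intro scaleR_right_mono mult_left_mono norm_mono_nonneg order_unit_nonneg) auto
  finally show "T y \<le> (norm T * norm x) *\<^sub>R order_unit" .
qed

lemma pos_op_upper: "0 \<le> y \<Longrightarrow> y \<le> x \<Longrightarrow> blinfun_apply T y \<le> pos_op T x"
  unfolding pos_op_def by (rule cSup_upper[OF _ bdd_above_pos_op]) auto

lemma pos_op_least: "0 \<le> x \<Longrightarrow> (\<And>y. 0 \<le> y \<Longrightarrow> y \<le> x \<Longrightarrow> blinfun_apply T y \<le> z) \<Longrightarrow> pos_op T x \<le> z"
  unfolding pos_op_def by (rule cSup_least) auto

lemma pos_op_nonneg: "0 \<le> x \<Longrightarrow> 0 \<le> pos_op T x"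
  using pos_op_upper[of 0 x T] by simp

lemma pos_op_add:
  assumes x: "0 \<le> x" and y: "0 \<le> y"
  shows "pos_op T (x + y) = pos_op T x + pos_op T y"
proof (rule order.antisym)
  show "pos_op T (x + y) \<le> pos_op T x + pos_op T y"
  proof (rule pos_op_least)
    fix z assume z: "0 \<le> z" "z \<le> x + y"
    have 1: "0 \<le> inf z x" "inf z x \<le> x" "inf z x \<le> z"
      using x z by auto
    have "z - inf z x = sup 0 (z - x)"
      by (simp add: diff_inf_eq_sup add_sup_distrib_left)
    also have "\<dots> \<le> y" using z y by (simp add: algebra_simps)
    finally have 2: "z - inf z x \<le> y" .
    have "T z = T (inf z x) + T (z - inf z x)"
      by (simp only: blinfun.diff_right add_diff_eq diff_add_cancel add_diff_cancel_left')
    also have "\<dots> \<le> pos_op T x + pos_op T y"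
      using 1 2 by (intro add_mono pos_op_upper) (simp_all only: diff_ge_0_iff_ge)
    finally show "T z \<le> pos_op T x + pos_op T y" .
  qed (use x y in auto)
next
  have "pos_op T x \<le> pos_op T (x + y) - pos_op T y"
  proof (rule pos_op_least[OF x])
    fix u assume u: "0 \<le> u" "u \<le> x"
    have "pos_op T y \<le> pos_op T (x + y) - T u"
    proof (rule pos_op_least[OF y])
      fix v assume v: "0 \<le> v" "v \<le> y"
      have "T (u + v) \<le> pos_op T (x + y)"
        using u v by (intro pos_op_upper add_mono add_nonneg_nonneg)
      then show "T v \<le> pos_op T (x + y) - T u"
        by (simp add: blinfun.bilinear_simps algebra_simps)
    qed
    then show "T u \<le> pos_op T (x + y) - pos_op T y"
      by (simp add: algebra_simps)
  qed
  then show "pos_op T x + pos_op T y \<le> pos_op T (x + y)"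
    by (simp add: algebra_simps)
qed

lemma pos_op_scaleR_le:
  assumes c: "0 < c" and x: "0 \<le> x"
  shows "pos_op T (c *\<^sub>R x) \<le> c *\<^sub>R pos_op T x"
proof (rule pos_op_least)
  show "0 \<le> c *\<^sub>R x" using c x by (simp add: scaleR_nonneg_nonneg)
  fix y assume y: "0 \<le> y" "y \<le> c *\<^sub>R x"
  have "inverse c *\<^sub>R y \<le> x"
    using y c by (simp add: pos_divideR_le_eq)
  moreover have "0 \<le> inverse c *\<^sub>R y"
    using y c by (intro scaleR_nonneg_nonneg) auto
  ultimately have "c *\<^sub>R T (inverse c *\<^sub>R y) \<le> c *\<^sub>R pos_op T x"
    using c by (intro scaleR_left_mono pos_op_upper) auto
  then show "T y \<le> c *\<^sub>R pos_op T x"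
    using c by (simp add: blinfun.bilinear_simps)
qed

lemma pos_op_scaleR:
  assumes c: "0 \<le> c" and x: "0 \<le> x"
  shows "pos_op T (c *\<^sub>R x) = c *\<^sub>R pos_op T x"
proof (cases "c = 0")
  case True
  have "pos_op T 0 \<le> 0" by (rule pos_op_least) auto
  then show ?thesis using True pos_op_nonneg[of 0 T] by simp
next
  case False
  with c have c: "c > 0" by simp
  have "pos_op T x = pos_op T (inverse c *\<^sub>R (c *\<^sub>R x))" using c by simp
  also have "\<dots> \<le> inverse c *\<^sub>R pos_op T (c *\<^sub>R x)"
    using c x by (intro pos_op_scaleR_le) (auto simp: scaleR_nonneg_nonneg)
  finally have "c *\<^sub>R pos_op T x \<le> c *\<^sub>R (inverse c *\<^sub>R pos_op T (c *\<^sub>R x))"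
    using c by (intro scaleR_left_mono) auto
  then have "c *\<^sub>R pos_op T x \<le> pos_op T (c *\<^sub>R x)" using c by simp
  with pos_op_scaleR_le[OF c x, of T] show ?thesis by (rule order.antisym)
qed

lemma pos_op_norm_le:
  assumes "0 \<le> x"
  shows "norm (pos_op T x) \<le> norm T * norm x"
proof -
  have "pos_op T x \<le> (norm T * norm x) *\<^sub>R order_unit"
  proof (rule pos_op_least[OF assms])
    fix y assume y: "0 \<le> y" "y \<le> x"
    have "T y \<le> (norm T * norm y) *\<^sub>R order_unit"
      using blinfun_le_order_unit[of T y] abs_ge_self order_trans by blast
    also have "\<dots> \<le> (norm T * norm x) *\<^sub>R order_unit"
      using y by (intro scaleR_right_mono mult_left_mono norm_mono_nonneg order_unit_nonneg) auto
    finally show "T y \<le> (norm T * norm x) *\<^sub>R order_unit" .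
  qed
  then show ?thesis
    using pos_op_nonneg[OF assms, of T] by (subst norm_le_iff_order_unit) auto
qed

lift_definition pos_part_op ::
    "('a::banach_lattice \<Rightarrow>\<^sub>L 'b::unital_banach_lattice) \<Rightarrow> ('a \<Rightarrow>\<^sub>L 'b)"
  is "\<lambda>T x. pos_op T (pprt x) - pos_op T (- nprt x)"
proof -
  fix T :: "'a \<Rightarrow>\<^sub>L 'b"
  let ?p = "pos_op T" and ?f = "\<lambda>x. pos_op T (pprt x) - pos_op T (- nprt x)"
  have split: "?f x = ?p u - ?p v" if "0 \<le> u" "0 \<le> v" "x = u - v" for x u v
  proof -
    have "u + (- nprt x) = pprt x + v"
      using that(3) prts[of x] by (simp add: algebra_simps)
    then have "?p (u + (- nprt x)) = ?p (pprt x + v)" by simp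
    then have "?p u + ?p (- nprt x) = ?p (pprt x) + ?p v"
      using that by (simp only: pos_op_add zero_le_pprt neg_0_le_iff_le nprt_le_zero)
    then show ?thesis by (simp add: algebra_simps)
  qed
  show "bounded_linear ?f"
  proof (rule bounded_linear_intro)
    fix x y :: 'a
    have xy: "x + y = (pprt x + pprt y) - (- nprt x + - nprt y)"
    proof -
      have "x + y = (pprt x + nprt x) + (pprt y + nprt y)" by (simp only: prts[symmetric])
      then show ?thesis by (simp add: algebra_simps)
    qed
    have "?f (x + y) = ?p (pprt x + pprt y) - ?p (- nprt x + - nprt y)"
      by (rule split[OF _ _ xy]) (intro add_nonneg_nonneg; simp)+
    also have "\<dots> = ?f x + ?f y"
      using pos_op_add[of "pprt x" "pprt y" T] pos_op_add[of "- nprt x" "- nprt y" T] by simp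
    finally show "?f (x + y) = ?f x + ?f y" .
  next
    fix r :: real and x :: 'a
    show "?f (r *\<^sub>R x) = r *\<^sub>R ?f x"
    proof (cases "r \<ge> 0")
      case True
      have rx: "r *\<^sub>R x = r *\<^sub>R pprt x - r *\<^sub>R (- nprt x)"
        by (subst prts[of x]) (simp add: scaleR_add_right)
      have "?f (r *\<^sub>R x) = ?p (r *\<^sub>R pprt x) - ?p (r *\<^sub>R (- nprt x))"
        by (rule split[OF _ _ rx]) (auto intro!: scaleR_nonneg_nonneg simp: True simp del: scaleR_minus_right)
      then show ?thesis using True
        by (simp add: pos_op_scaleR scaleR_diff_right del: scaleR_minus_right)
    next
      case False
      have rx: "r *\<^sub>R x = (- r) *\<^sub>R (- nprt x) - (- r) *\<^sub>R pprt x"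
        by (subst prts[of x]) (simp add: scaleR_add_right)
      have "?f (r *\<^sub>R x) = ?p ((- r) *\<^sub>R (- nprt x)) - ?p ((- r) *\<^sub>R pprt x)"
        by (rule split[OF _ _ rx]) (use False in \<open>auto intro!: scaleR_nonneg_nonneg
          simp del: scaleR_minus_right scaleR_minus_left\<close>)
      also have "\<dots> = (- r) *\<^sub>R ?p (- nprt x) - (- r) *\<^sub>R ?p (pprt x)"
        using False by (simp add: pos_op_scaleR del: scaleR_minus_right scaleR_minus_left)
      finally show ?thesis by (simp add: scaleR_diff_right)
    qed
  next
    fix x :: 'a
    have "\<bar>?f x\<bar> \<le> ?p (pprt x) + ?p (- nprt x)"
      using abs_triangle_ineq4[of "?p (pprt x)" "?p (- nprt x)"] by (simp add: pos_op_nonneg)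
    also have "\<dots> = ?p \<bar>x\<bar>"
      by (subst pos_op_add[symmetric]) (auto simp: abs_prts)
    finally have "norm (?f x) \<le> norm (?p \<bar>x\<bar>)"
      by (intro norm_mono_abs) (simp add: pos_op_nonneg)
    also have "\<dots> \<le> norm T * norm \<bar>x\<bar>" by (rule pos_op_norm_le) simp
    finally show "norm (?f x) \<le> norm x * norm T" by (simp add: norm_abs_eq mult.commute)
  qed
qed

lemma pos_part_op_apply: "0 \<le> x \<Longrightarrow> pos_part_op T x = pos_op T x"
  using pos_op_scaleR[of 0 0 T] by transfer simp

text \<open>
  Operators are ordered by \<open>S \<le> T \<longleftrightarrow> (\<forall>x\<ge>0. S x \<le> T x)\<close>. The supremum is given by the
  Riesz--Kantorovich formula \<open>S \<squnion> T = S + (T - S)\<^sup>+\<close>, where \<open>R\<^sup>+ x = Sup {R y | 0 \<le> y \<le> x}\<close>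
  for \<open>x \<ge> 0\<close>.
\<close>

instantiation blinfun :: (banach_lattice, unital_banach_lattice) banach_lattice
begin

definition less_eq_blinfun :: "('a \<Rightarrow>\<^sub>L 'b) \<Rightarrow> ('a \<Rightarrow>\<^sub>L 'b) \<Rightarrow> bool"
  where "S \<le> T \<longleftrightarrow> (\<forall>x\<ge>0. blinfun_apply S x \<le> blinfun_apply T x)"

definition less_blinfun :: "('a \<Rightarrow>\<^sub>L 'b) \<Rightarrow> ('a \<Rightarrow>\<^sub>L 'b) \<Rightarrow> bool"
  where "S < T \<longleftrightarrow> S \<le> T \<and> \<not> T \<le> (S :: 'a \<Rightarrow>\<^sub>L 'b)"

definition sup_blinfun :: "('a \<Rightarrow>\<^sub>L 'b) \<Rightarrow> ('a \<Rightarrow>\<^sub>L 'b) \<Rightarrow> ('a \<Rightarrow>\<^sub>L 'b)"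
  where "sup S T = S + pos_part_op (T - S)"

definition inf_blinfun :: "('a \<Rightarrow>\<^sub>L 'b) \<Rightarrow> ('a \<Rightarrow>\<^sub>L 'b) \<Rightarrow> ('a \<Rightarrow>\<^sub>L 'b)"
  where "inf S T = - sup (- S) (- T :: 'a \<Rightarrow>\<^sub>L 'b)"

definition abs_blinfun :: "('a \<Rightarrow>\<^sub>L 'b) \<Rightarrow> ('a \<Rightarrow>\<^sub>L 'b)"
  where "\<bar>T\<bar> = sup T (- T :: 'a \<Rightarrow>\<^sub>L 'b)"

instance
proof
  fix S T U :: "'a \<Rightarrow>\<^sub>L 'b" and a b :: real
  note le = less_eq_blinfun_def
  show "S < T \<longleftrightarrow> S \<le> T \<and> \<not> T \<le> S" by (fact less_blinfun_def)
  show "S \<le> S" by (simp add: le)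
  show "S \<le> U" if "S \<le> T" "T \<le> U" using that unfolding le by (meson order_trans)
  show "S = T" if "S \<le> T" "T \<le> S"
  proof (rule blinfun_eqI)
    fix x :: 'a
    have *: "S y = T y" if "0 \<le> y" for y :: 'a
      using \<open>S \<le> T\<close> \<open>T \<le> S\<close> that unfolding le by (simp add: order.antisym)
    have "x = pprt x - (- nprt x)" using prts[of x] by simp
    then show "S x = T x"
      using *[OF zero_le_pprt[of x]] *[of "- nprt x"]
      by (metis blinfun.diff_right neg_0_le_iff_le nprt_le_zero)
  qed
  show "U + S \<le> U + T" if "S \<le> T"
    using that by (simp add: le blinfun.bilinear_simps)
  show "a *\<^sub>R S \<le> a *\<^sub>R T" if "S \<le> T" "0 \<le> a"
    using that by (auto simp: le blinfun.bilinear_simps intro: scaleR_left_mono)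
  show "a *\<^sub>R S \<le> b *\<^sub>R S" if "a \<le> b" "0 \<le> S"
    using that by (auto simp: le blinfun.bilinear_simps intro: scaleR_right_mono)
  have sup1: "S \<le> sup S T" for S T :: "'a \<Rightarrow>\<^sub>L 'b"
    by (simp add: le sup_blinfun_def blinfun.bilinear_simps pos_part_op_apply pos_op_nonneg)
  have sup2: "T \<le> sup S T" for S T :: "'a \<Rightarrow>\<^sub>L 'b"
    unfolding le
  proof (intro allI impI)
    fix x :: 'a assume "0 \<le> x"
    then have "(T - S) x \<le> pos_op (T - S) x" by (intro pos_op_upper) auto
    then show "T x \<le> sup S T x"
      using \<open>0 \<le> x\<close> by (simp add: sup_blinfun_def blinfun.bilinear_simps pos_part_op_apply algebra_simps)
  qed
  have sup3: "sup S T \<le> U" if "S \<le> U" "T \<le> U" for S T U :: "'a \<Rightarrow>\<^sub>L 'b"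
    unfolding le
  proof (intro allI impI)
    fix x :: 'a assume x: "0 \<le> x"
    have "pos_op (T - S) x \<le> U x - S x"
    proof (rule pos_op_least[OF x])
      fix y assume y: "0 \<le> y" "y \<le> x"
      have "T y \<le> U y" "S (x - y) \<le> U (x - y)" using that y by (auto simp: le)
      then have "T y + S (x - y) \<le> U y + U (x - y)" by (rule add_mono)
      then show "(T - S) y \<le> U x - S x"
        by (simp add: blinfun.bilinear_simps algebra_simps)
    qed
    then show "sup S T x \<le> U x"
      using x by (simp add: sup_blinfun_def blinfun.bilinear_simps pos_part_op_apply algebra_simps)
  qed
  have neg: "- S \<le> - T \<longleftrightarrow> T \<le> S" for S T :: "'a \<Rightarrow>\<^sub>L 'b"
    by (simp add: le blinfun.bilinear_simps)
  show "S \<le> sup S T" "T \<le> sup S T" by (fact sup1 sup2)+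
  show "sup S T \<le> U" if "S \<le> U" "T \<le> U" using that by (rule sup3)
  show "inf S T \<le> S" using neg[of "sup (- S) (- T)" "- S"] sup1[of "- S" "- T"]
    by (simp add: inf_blinfun_def)
  show "inf S T \<le> T" using neg[of "sup (- S) (- T)" "- T"] sup2[of "- T" "- S"]
    by (simp add: inf_blinfun_def)
  show "S \<le> inf T U" if "S \<le> T" "S \<le> U"
    using neg[of "- S" "sup (- T) (- U)"] sup3[of "- T" "- S" "- U"] that
    by (simp add: inf_blinfun_def neg)
  show "\<bar>S\<bar> = sup S (- S)" by (fact abs_blinfun_def)
  have abs_apply: "\<bar>S x\<bar> \<le> \<bar>S\<bar> \<bar>x\<bar>" for S :: "'a \<Rightarrow>\<^sub>L 'b" and x :: 'a
  proof -
    have a: "S y \<le> \<bar>S\<bar> y" "- S y \<le> \<bar>S\<bar> y" if "0 \<le> y" for y :: 'a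
      using sup1[of S "- S"] sup2[of "- S" S] that by (auto simp: abs_blinfun_def le blinfun.bilinear_simps)
    have x: "x = pprt x + nprt x" "\<bar>x\<bar> = pprt x - nprt x"
      by (simp_all add: prts[symmetric] abs_prts)
    have Sx: "S x = S (pprt x) - S (- nprt x)" "\<bar>S\<bar> \<bar>x\<bar> = \<bar>S\<bar> (pprt x) + \<bar>S\<bar> (- nprt x)"
      by (subst x, simp add: blinfun.bilinear_simps)+
    have "S (pprt x) + - S (- nprt x) \<le> \<bar>S\<bar> (pprt x) + \<bar>S\<bar> (- nprt x)"
      by (intro add_mono a) auto
    moreover have "- S (pprt x) + S (- nprt x) \<le> \<bar>S\<bar> (pprt x) + \<bar>S\<bar> (- nprt x)"
      by (intro add_mono a) auto
    ultimately show ?thesis unfolding Sx by (intro abs_leI) simp_all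
  qed
  have abs_norm: "norm (\<bar>T\<bar> x) \<le> norm T * norm x" if x: "0 \<le> x" for T :: "'a \<Rightarrow>\<^sub>L 'b" and x :: 'a
  proof -
    have "pos_op (- T - T) x \<le> (norm T * norm x) *\<^sub>R order_unit - T x"
    proof (rule pos_op_least[OF x])
      fix y assume y: "0 \<le> y" "y \<le> x"
      have "\<bar>x - (y + y)\<bar> \<le> x"
        using y add_mono[OF y(2) y(2)] by (intro abs_leI) (simp_all add: algebra_simps)
      then have n: "norm (x - (y + y)) \<le> norm x" by (intro norm_mono_abs) (simp add: x)
      have "T (x - (y + y)) \<le> (norm T * norm (x - (y + y))) *\<^sub>R order_unit"
        using blinfun_le_order_unit abs_ge_self order_trans by blast
      also have "\<dots> \<le> (norm T * norm x) *\<^sub>R order_unit"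
        using n by (intro scaleR_right_mono mult_left_mono order_unit_nonneg) auto
      finally show "(- T - T) y \<le> (norm T * norm x) *\<^sub>R order_unit - T x"
        by (simp add: blinfun.bilinear_simps algebra_simps)
    qed
    then have "\<bar>T\<bar> x \<le> (norm T * norm x) *\<^sub>R order_unit"
      using x by (simp add: abs_blinfun_def sup_blinfun_def blinfun.bilinear_simps pos_part_op_apply algebra_simps)
    moreover have "0 \<le> \<bar>T\<bar> x"
      using abs_apply[of T x] abs_ge_zero[of "T x"] x by (metis abs_of_nonneg order_trans)
    ultimately show ?thesis by (subst norm_le_iff_order_unit) auto
  qed
  show "norm S \<le> norm T" if ST: "\<bar>S\<bar> \<le> \<bar>T\<bar>"
  proof (rule norm_blinfun_bound)
    fix x :: 'a
    have "\<bar>S x\<bar> \<le> \<bar>T\<bar> \<bar>x\<bar>"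
      using abs_apply[of S x] ST unfolding le by (meson abs_ge_zero order_trans)
    then have "norm (S x) \<le> norm (\<bar>T\<bar> \<bar>x\<bar>)"
      by (intro norm_mono_abs) (meson abs_ge_self order_trans)
    also have "\<dots> \<le> norm T * norm \<bar>x\<bar>" by (rule abs_norm) simp
    finally show "norm (S x) \<le> norm T * norm x" by (simp add: norm_abs_eq)
  qed simp
qed

end


section \<open>Weak topologies and adjoints\<close>

definition weak_topology :: "'a::real_normed_vector topology"
  where "weak_topology = pullback_topology UNIV (\<lambda>x f. blinfun_apply (f :: 'a \<Rightarrow>\<^sub>L real) x) euclidean"

text \<open>
  The weak* topology is the topology of pointwise convergence of functionals, that is, the strong
  operator topology for operators into \<^typ>\<open>real\<close>.
\<close>

definition weak_star_topology :: "('a::real_normed_vector \<Rightarrow>\<^sub>L real) topology"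
  where "weak_star_topology = strong_operator_topology"

lemma limitin_pullback_UNIV:
  "limitin (pullback_topology UNIV g euclidean) x l F \<longleftrightarrow> ((\<lambda>n. g (x n)) \<longlongrightarrow> g l) F"
proof
  assume L: "limitin (pullback_topology UNIV g euclidean) x l F"
  show "((\<lambda>n. g (x n)) \<longlongrightarrow> g l) F"
  proof (rule topological_tendstoI)
    fix U assume "open U" "g l \<in> U"
    then have "openin (pullback_topology UNIV g euclidean) (g -` U)" "l \<in> g -` U"
      by (auto simp: openin_pullback_topology)
    with L have "\<forall>\<^sub>F n in F. x n \<in> g -` U" unfolding limitin_def by blast
    then show "\<forall>\<^sub>F n in F. g (x n) \<in> U" by simp
  qed
next
  assume "((\<lambda>n. g (x n)) \<longlongrightarrow> g l) F"
  then show "limitin (pullback_topology UNIV g euclidean) x l F"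
    by (auto simp: limitin_def topspace_pullback_topology openin_pullback_topology
        dest: topological_tendstoD)
qed

lemma tendsto_pointwise_iff:
  fixes l :: "'a \<Rightarrow> 'b::topological_space"
  shows "(f \<longlongrightarrow> l) F \<longleftrightarrow> (\<forall>i. ((\<lambda>n. f n i) \<longlongrightarrow> l i) F)"
proof -
  have "(f \<longlongrightarrow> l) F \<longleftrightarrow> limitin (product_topology (\<lambda>_. euclidean) UNIV) f l F"
    by (simp only: limitin_canonical_iff[symmetric] euclidean_product_topology)
  also have "\<dots> \<longleftrightarrow> (\<forall>i. ((\<lambda>n. f n i) \<longlongrightarrow> l i) F)"
    by (subst limitin_componentwise) simp
  finally show ?thesis .
qed

lemma limitin_weak_topology:
  fixes x :: "nat \<Rightarrow> 'a::real_normed_vector"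
  shows "limitin weak_topology x l sequentially \<longleftrightarrow> (\<forall>f :: 'a \<Rightarrow>\<^sub>L real. (\<lambda>n. f (x n)) \<longlonglongrightarrow> f l)"
  unfolding weak_topology_def limitin_pullback_UNIV
  by (simp only: tendsto_pointwise_iff)

lemma limitin_weak_star_topology:
  "limitin weak_star_topology f l sequentially \<longleftrightarrow> (\<forall>x. (\<lambda>n. f n x) \<longlonglongrightarrow> l x)"
  unfolding weak_star_topology_def strong_operator_topology_def limitin_pullback_UNIV
  by (simp only: tendsto_pointwise_iff)

lift_definition banach_adjoint ::
    "('a::real_normed_vector \<Rightarrow>\<^sub>L 'b::real_normed_vector) \<Rightarrow> (('b \<Rightarrow>\<^sub>L real) \<Rightarrow>\<^sub>L ('a \<Rightarrow>\<^sub>L real))"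
  is "\<lambda>T f. f o\<^sub>L T"
  by (rule bounded_bilinear.bounded_linear_left[OF bounded_bilinear_blinfun_compose])

lemma banach_adjoint_apply: "banach_adjoint T f x = f (T x)"
  by transfer simp


section \<open>Classes of operators and Banach lattices\<close>

definition disjoint_sequence :: "(nat \<Rightarrow> 'a::banach_lattice) \<Rightarrow> bool"
  where "disjoint_sequence x \<longleftrightarrow> (\<forall>m n. m \<noteq> n \<longrightarrow> inf \<bar>x m\<bar> \<bar>x n\<bar> = 0)"

definition dual_positive_schur :: "'a::banach_lattice itself \<Rightarrow> bool"
  where "dual_positive_schur _ \<longleftrightarrow>
    (\<forall>f :: nat \<Rightarrow> 'a \<Rightarrow>\<^sub>L real.
       (\<forall>n. 0 \<le> f n) \<and> limitin weak_star_topology f 0 sequentially \<longrightarrow> f \<longlonglongrightarrow> 0)"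

definition relatively_weakly_compact :: "'a::real_normed_vector set \<Rightarrow> bool"
  where "relatively_weakly_compact A \<longleftrightarrow> compactin weak_topology (weak_topology closure_of A)"

definition order_weakly_compact :: "('a::banach_lattice \<Rightarrow>\<^sub>L 'b::banach) \<Rightarrow> bool"
  where "order_weakly_compact T \<longleftrightarrow>
    (\<forall>x\<ge>0. relatively_weakly_compact (blinfun_apply T ` {0..x}))"

definition almost_limited :: "('a::banach \<Rightarrow>\<^sub>L 'b::banach_lattice) \<Rightarrow> bool"
  where "almost_limited S \<longleftrightarrow>
    (\<forall>f :: nat \<Rightarrow> 'b \<Rightarrow>\<^sub>L real.
       disjoint_sequence f \<and> limitin weak_star_topology f 0 sequentially
       \<longrightarrow> (\<lambda>n. banach_adjoint S (f n)) \<longlonglongrightarrow> 0)"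

definition almost_dunford_pettis :: "('a::banach_lattice \<Rightarrow>\<^sub>L 'b::banach) \<Rightarrow> bool"
  where "almost_dunford_pettis T \<longleftrightarrow>
    (\<forall>x. disjoint_sequence x \<and> limitin weak_topology x 0 sequentially \<longrightarrow> (\<lambda>n. T (x n)) \<longlonglongrightarrow> 0)"

end

theory Submission
  imports Defs
begin

text \<open>
  Write \<open>T\<^sup>*\<^sup>*\<close> for the biadjoint. Both conclusions concern a disjoint sequence \<open>p\<close> in the bidual
  which is weak* null, hence norm bounded by the uniform boundedness principle (weakly null sequences
  in the bidual are weak* null). The point is that \<open>T\<^sup>*\<^sup>*\<close> sends bounded disjoint sequences of the
  bidual to norm null sequences. Since
    \<open>\<bar>(T\<^sup>*\<^sup>* p\<^sub>n) g\<bar> \<le> \<bar>p\<^sub>n\<bar> \<bar>T\<^sup>* g\<bar> \<le> \<bar>p\<^sub>n\<bar> u + \<parallel>p\<^sub>n\<parallel> \<parallel>(\<bar>T\<^sup>* g\<bar> - u)\<^sup>+\<parallel>\<close>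
  for every positive functional \<open>u\<close>, two facts suffice.

  The first is that \<open>\<bar>p\<^sub>n\<bar> u\<close> tends to \<open>0\<close> for each \<open>u \<ge> 0\<close> in \<open>E\<^sup>*\<close>. If a disjoint bounded sequence of
  positive functionals stays away from \<open>0\<close> at \<open>u\<close>, then \<open>u\<close> can be cut into pieces \<open>z\<^sub>j \<ge> 0\<close> with
  partial sums below \<open>u\<close>, on each of which one of the functionals stays away from \<open>0\<close>
  (\<open>disjoint_functionals_witnesses\<close>, by repeated use of the pigeonhole principle). Here the \<open>z\<^sub>j\<close> are
  positive functionals on \<open>E\<close> whose values at any positive element are summable, so they are weak* null
  and by hypothesis norm null, a contradiction.

  The second is that for every \<open>\<epsilon> > 0\<close> one \<open>u\<close> makes \<open>\<parallel>(\<bar>T\<^sup>* g\<bar> - u)\<^sup>+\<parallel> \<le> \<epsilon>\<close> for all \<open>g\<close> in the unit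
  ball. Otherwise the classical disjointification \<open>almost_order_bounded_if_disjoint_null\<close> yields
  disjoint functionals \<open>0 \<le> h\<^sub>n \<le> \<bar>T\<^sup>* g\<^sub>n\<bar>\<close> that are not norm null. By the dual positive Schur property
  they cannot be weak* null, so they stay away from \<open>0\<close> at some \<open>x \<ge> 0\<close> along a subsequence. Cutting
  \<open>x\<close> into pieces as before gives \<open>y\<^sub>j \<ge> 0\<close> with partial sums below \<open>x\<close> and \<open>\<bar>g\<^sub>j (T y\<^sub>j)\<bar>\<close> bounded away
  from \<open>0\<close>. This contradicts the relative weak compactness of \<open>T [0, x]\<close>
  (\<open>order_weakly_compact_diagonal\<close>). That last step is a double limit argument in the style of
  Grothendieck: a weak cluster point of partial sums of \<open>T y\<^sub>j\<close> is paired with a weak* cluster point of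
  the \<open>g\<^sub>j\<close>, and the two iterated limits disagree.
\<close>

section \<open>Functionals on a Banach lattice\<close>

lemma blinfun_nonneg:
  fixes h :: "'a::banach_lattice \<Rightarrow>\<^sub>L real"
  shows "0 \<le> h \<Longrightarrow> 0 \<le> x \<Longrightarrow> 0 \<le> h x"
  by (simp add: less_eq_blinfun_def)

lemma blinfun_mono:
  fixes h :: "'a::banach_lattice \<Rightarrow>\<^sub>L real"
  assumes "0 \<le> h" "x \<le> y"
  shows "h x \<le> h y"
  using blinfun_nonneg[OF assms(1), of "y - x"] assms(2) by (simp add: blinfun.diff_right)

lemma blinfun_abs_le_nonneg:
  fixes f :: "'a::banach_lattice \<Rightarrow>\<^sub>L real"
  assumes "0 \<le> x"
  shows "\<bar>f x\<bar> \<le> \<bar>f\<bar> x"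
  using abs_ge_self[of f] abs_ge_minus_self[of f] assms
  by (auto simp: less_eq_blinfun_def blinfun.minus_left abs_le_iff)

lemma blinfun_abs_le:
  fixes f :: "'a::banach_lattice \<Rightarrow>\<^sub>L real"
  shows "\<bar>f x\<bar> \<le> \<bar>f\<bar> \<bar>x\<bar>"
proof -
  have "f x = f (pprt x) - f (- nprt x)"
    by (subst prts[of x]) (simp only: blinfun.add_right blinfun.minus_right)
  then have "\<bar>f x\<bar> \<le> \<bar>f (pprt x)\<bar> + \<bar>f (- nprt x)\<bar>" by simp
  also have "\<dots> \<le> \<bar>f\<bar> (pprt x) + \<bar>f\<bar> (- nprt x)"
    by (intro add_mono blinfun_abs_le_nonneg) auto
  also have "\<dots> = \<bar>f\<bar> \<bar>x\<bar>" by (simp add: abs_prts blinfun.diff_right blinfun.minus_right)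
  finally show ?thesis .
qed

text \<open>
  The modulus at \<open>x\<close> is a supremum over the symmetric interval \<open>[-x, x]\<close>, while the operator is only
  controlled on \<open>[0, x]\<close>; the factor \<open>3\<close> comes from \<open>\<bar>f\<bar> = f + (- 2 f)\<^sup>+\<close>.
\<close>

lemma blinfun_abs_apply_le:
  fixes f :: "'a::banach_lattice \<Rightarrow>\<^sub>L real"
  assumes x: "0 \<le> x" and c: "\<And>y. 0 \<le> y \<Longrightarrow> y \<le> x \<Longrightarrow> \<bar>f y\<bar> \<le> c"
  shows "\<bar>f\<bar> x \<le> 3 * c"
proof -
  have "pos_op (- f - f) x \<le> 2 * c"
  proof (rule pos_op_least[OF x])
    fix y assume "0 \<le> y" "y \<le> x"
    then show "(- f - f) y \<le> 2 * c"
      using c[of y] by (simp add: blinfun.bilinear_simps abs_le_iff)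
  qed
  then show ?thesis
    using c[OF x order.refl] x
    by (simp add: abs_blinfun_def sup_blinfun_def blinfun.add_left pos_part_op_apply abs_le_iff)
qed

text \<open>
  The Riesz--Kantorovich formula \<open>(inf h k) x = Inf {h (x - y) + k y | 0 \<le> y \<le> x}\<close>: disjoint
  functionals are almost carried by complementary parts of \<open>x\<close>.
\<close>

lemma disjoint_functionals_split:
  fixes h k :: "'a::banach_lattice \<Rightarrow>\<^sub>L real"
  assumes disj: "inf h k = 0" and x: "0 \<le> x" and e: "0 < e"
  shows "\<exists>y. 0 \<le> y \<and> y \<le> x \<and> h (x - y) + k y < e"
proof -
  have "h = pos_part_op (h - k)"
    using disj by (simp add: inf_blinfun_def sup_blinfun_def add.commute)
  then have "h x = pos_op (h - k) x"
    using x by (metis pos_part_op_apply)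
  then have "h x - e < Sup (blinfun_apply (h - k) ` {0..x})"
    using e by (simp add: pos_op_def)
  then obtain y where "y \<in> {0..x}" "h x - e < (h - k) y"
    using x by (subst (asm) less_cSup_iff[OF _ bdd_above_pos_op]) auto
  then show ?thesis
    by (intro exI[of _ y]) (auto simp: blinfun.bilinear_simps)
qed

lemma inf_add_eq_0:
  fixes a b c :: "'a::lattice_ab_group_add"
  assumes "0 \<le> a" "0 \<le> b" "0 \<le> c" "inf a c = 0" "inf b c = 0"
  shows "inf (a + b) c = 0"
proof (rule order.antisym)
  let ?w = "inf (a + b) c"
  \<comment> \<open>Subtracting \<open>b\<close> brings \<open>?w\<close> below both \<open>a\<close> and \<open>c\<close>, so \<open>?w \<le> b\<close>, and then \<open>?w \<le> inf b c\<close>.\<close>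
  have "?w - b \<le> a" by (simp add: diff_le_eq)
  moreover have "?w - b \<le> c" using assms(2) by (meson add_increasing2 diff_le_eq inf.cobounded2 order_trans)
  ultimately have "?w - b \<le> inf a c" by simp
  then have "?w \<le> b" using assms(4) by simp
  then have "?w \<le> inf b c" by simp
  then show "?w \<le> 0" using assms(5) by simp
qed (use assms in auto)

lemma inf_sum_eq_0:
  fixes a :: "'i \<Rightarrow> 'a::lattice_ab_group_add"
  assumes "finite I" "\<And>i. i \<in> I \<Longrightarrow> 0 \<le> a i" "0 \<le> c" "\<And>i. i \<in> I \<Longrightarrow> inf (a i) c = 0"
  shows "inf (sum a I) c = 0"
  using assms
proof (induction rule: finite_induct)
  case empty
  then show ?case by (simp add: inf_absorb1)
next
  case (insert i I)
  then show ?case by (auto intro!: inf_add_eq_0 sum_nonneg)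
qed

text \<open>
  Induction on the index set: \<open>h i\<close> is disjoint from the sum of the others, so \<open>x\<close> splits into a part
  \<open>x - y\<close> that almost carries \<open>h i\<close> and a part \<open>y\<close> that almost carries all the others.
\<close>

lemma disjoint_functionals_decompose:
  fixes h :: "'i \<Rightarrow> 'a::banach_lattice \<Rightarrow>\<^sub>L real"
  assumes I: "finite I" and pos: "\<And>i. i \<in> I \<Longrightarrow> 0 \<le> h i"
    and disj: "\<And>i j. i \<in> I \<Longrightarrow> j \<in> I \<Longrightarrow> i \<noteq> j \<Longrightarrow> inf (h i) (h j) = 0"
    and x: "0 \<le> x" and e: "0 < e"
  shows "\<exists>y. (\<forall>i\<in>I. 0 \<le> y i \<and> h i x - e \<le> h i (y i)) \<and> sum y I \<le> x"
  using I pos disj x e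
proof (induction I arbitrary: x e rule: finite_induct)
  case empty
  then show ?case by auto
next
  case (insert i I)
  have ne: "j \<noteq> i" if "j \<in> I" for j using that insert.hyps by blast
  have "inf (\<Sum>j\<in>I. h j) (h i) = 0"
    using insert ne by (intro inf_sum_eq_0) auto
  from disjoint_functionals_split[OF this insert.prems(3), of "e / 2"] insert.prems
  obtain y where y: "0 \<le> y" "y \<le> x" "(\<Sum>j\<in>I. h j) (x - y) + h i y < e / 2" by auto
  have xy: "0 \<le> x - y" using y by simp
  from insert.IH[OF _ _ y(1), of "e/2"] insert.prems(1,2,4) have
    "\<exists>z. (\<forall>j\<in>I. 0 \<le> z j \<and> h j y - e/2 \<le> h j (z j)) \<and> sum z I \<le> y" by auto
  then obtain z where
    z: "\<And>j. j \<in> I \<Longrightarrow> 0 \<le> z j \<and> h j y - e/2 \<le> h j (z j)" "sum z I \<le> y" by blast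
  have "0 \<le> h i y" using y insert.prems by (auto intro: blinfun_nonneg)
  moreover have sum_nn: "0 \<le> (\<Sum>j\<in>I. h j) (x - y)"
    using xy insert.prems by (auto intro!: blinfun_nonneg sum_nonneg)
  ultimately have small: "h i y \<le> e / 2" "(\<Sum>j\<in>I. h j) (x - y) \<le> e / 2" using y(3) by auto
  have I_small: "h j (x - y) \<le> e / 2" if "j \<in> I" for j
  proof -
    have "h j (x - y) \<le> (\<Sum>j\<in>I. h j (x - y))"
      using insert that xy by (intro member_le_sum blinfun_nonneg) auto
    with small(2) show ?thesis by (simp add: blinfun.sum_left)
  qed
  define w where "w = z(i := x - y)"
  have "sum w I = sum z I" by (rule sum.cong) (auto simp: w_def ne)
  then have "sum w (insert i I) \<le> x"
    using insert.hyps z(2) by (simp add: w_def algebra_simps)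
  moreover have "0 \<le> w j \<and> h j x - e \<le> h j (w j)" if "j \<in> insert i I" for j
  proof (cases "j = i")
    case True
    then show ?thesis using xy small(1) insert.prems(4) by (simp add: w_def blinfun.diff_right)
  next
    case False
    then have "j \<in> I" using that by simp
    then show ?thesis using False z(1)[of j] I_small[of j] by (simp add: w_def blinfun.diff_right)
  qed
  ultimately show ?case by blast
qed

text \<open>
  One step of the construction below. An infinite disjoint family does not split \<open>y\<close> all at once, since
  the error in a finite splitting is not uniform over the remaining functionals. Instead \<open>y\<close> is split
  among \<open>N > C / e\<close> of them. Each \<open>h n\<close> has total mass at most \<open>C\<close> on the \<open>N\<close> pieces, so some piece
  has mass at most \<open>e\<close>, and one and the same piece serves infinitely many \<open>n\<close>. Removing it from \<open>y\<close>
  costs these functionals only \<open>e\<close>.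
\<close>

lemma disjoint_functionals_split_off:
  fixes h :: "nat \<Rightarrow> 'a::banach_lattice \<Rightarrow>\<^sub>L real"
  assumes pos: "\<And>n. 0 \<le> h n" and disj: "\<And>m n. m \<noteq> n \<Longrightarrow> inf (h m) (h n) = 0"
    and bd: "\<And>n. h n y \<le> C" and y: "0 \<le> y" and e: "0 < e"
    and I: "infinite I" and d: "\<And>n. n \<in> I \<Longrightarrow> d \<le> h n y"
  shows "\<exists>j z J. j \<in> I \<and> 0 \<le> z \<and> z \<le> y \<and> d - e \<le> h j z \<and>
    infinite J \<and> J \<subseteq> I \<inter> {j<..} \<and> (\<forall>n\<in>J. d - e \<le> h n (y - z))"
proof -
  obtain N :: nat where N: "C / e < N" using reals_Archimedean2 by blast
  have "0 \<le> C" using order_trans[OF blinfun_nonneg[OF pos y] bd] .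
  then have "0 \<le> C / e" using e by simp
  with N have "0 < N" by (cases N) auto
  obtain A where A: "A \<subseteq> I" "finite A" "card A = N"
    using infinite_arbitrarily_large[OF I] by blast
  have "\<exists>z. (\<forall>i\<in>A. 0 \<le> z i \<and> h i y - e \<le> h i (z i)) \<and> sum z A \<le> y"
    by (rule disjoint_functionals_decompose[OF A(2) pos disj y e])
  then obtain z where z: "\<And>i. i \<in> A \<Longrightarrow> 0 \<le> z i \<and> h i y - e \<le> h i (z i)" and sum_z: "sum z A \<le> y"
    by blast
  have "\<exists>i\<in>A. h n (z i) \<le> e" for n
  proof (rule ccontr)
    assume "\<not> ?thesis"
    then have "(\<Sum>i\<in>A. e) \<le> (\<Sum>i\<in>A. h n (z i))" by (intro sum_mono) auto
    also have "\<dots> = h n (sum z A)" by (simp add: blinfun.sum_right)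
    also have "\<dots> \<le> C" using blinfun_mono[OF pos sum_z] bd order_trans by blast
    finally show False using N e A(3) by (simp add: field_simps)
  qed
  then obtain i where i: "i \<in> A" and inf_i: "infinite {n \<in> I. h n (z i) \<le> e}"
    using pigeonhole_infinite_rel[OF I A(2), of "\<lambda>n i. h n (z i) \<le> e"] by blast
  define J where "J = {n \<in> I. h n (z i) \<le> e} - {..i}"
  have "infinite J" using inf_i by (simp add: J_def)
  moreover have "z i \<le> y"
  proof -
    have "0 \<le> sum z (A - {i})" using z by (intro sum_nonneg) auto
    then have "z i \<le> sum z A" using sum.remove[OF A(2) i, of z] by simp
    then show ?thesis using sum_z by (rule order_trans)
  qed
  moreover have "d - e \<le> h n (y - z i)" if "n \<in> J" for n
    using that d[of n] by (auto simp: J_def blinfun.diff_right)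
  moreover have "d - e \<le> h i (z i)" using z[OF i] d[of i] i A(1) by force
  ultimately show ?thesis using z i A(1)
    by (intro exI[of _ i] exI[of _ "z i"] exI[of _ J]) (auto simp: J_def)
qed

text \<open>
  Splitting off pieces one after the other, with errors that add up to less than \<open>d / 2\<close>. The pieces
  \<open>z j\<close> are not disjoint, but bounded partial sums serve the same purpose: every functional is
  summable along them.
\<close>

lemma disjoint_functionals_witnesses:
  fixes h :: "nat \<Rightarrow> 'a::banach_lattice \<Rightarrow>\<^sub>L real"
  assumes pos: "\<And>n. 0 \<le> h n" and disj: "\<And>m n. m \<noteq> n \<Longrightarrow> inf (h m) (h n) = 0"
    and bd: "\<And>n. norm (h n) \<le> C" and x: "0 \<le> x" and d: "0 < d"
    and I: "infinite I" "\<And>n. n \<in> I \<Longrightarrow> d \<le> h n x"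
  shows "\<exists>(r :: nat \<Rightarrow> nat) z. strict_mono r \<and> (\<forall>j. 0 \<le> z j) \<and> (\<forall>j. sum z {..<j} \<le> x) \<and>
    (\<forall>j. d / 2 \<le> h (r j) (z j))"
proof -
  \<comment> \<open>A state \<open>(j, z, y, J)\<close> records the index and the piece chosen last, what is left of \<open>x\<close>,
     and the indices that are still admissible; \<open>c k\<close> bounds the values of their functionals at \<open>y\<close>
     from below.\<close>
  define c where "c k = d / 2 + d / 4 / 2 ^ k" for k :: nat
  have c: "c 0 = d - d / 4" "c k - d / 8 / 2 ^ k = c (Suc k)" "d / 8 / 2 ^ k > 0" "d / 2 \<le> c k" for k
    using d by (simp_all add: c_def field_simps)
  let ?P = "\<lambda>k (j::nat, z, y, J). (0 \<le> z \<and> 0 \<le> y \<and> infinite J \<and> J \<subseteq> {j<..} \<and> c k \<le> h j z \<and>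
    (\<forall>n\<in>J. c k \<le> h n y)) \<and> (k = 0 \<longrightarrow> y = x - z)"
  let ?Q = "\<lambda>k (j, z, y, J) (j', z', y', J'). j < j' \<and> y' = y - z'"
  have step: "\<exists>j z J. j \<in> J' \<and> 0 \<le> z \<and> z \<le> y \<and> t - e \<le> h j z \<and> infinite J \<and> J \<subseteq> J' \<inter> {j<..} \<and>
    (\<forall>n\<in>J. t - e \<le> h n (y - z))" if "0 \<le> y" "0 < e" "infinite J'" "\<forall>n\<in>J'. t \<le> h n y" for y e J' t
  proof (rule disjoint_functionals_split_off[OF pos disj _ that(1-3) bspec[OF that(4)]])
    show "h n y \<le> norm y * C" for n
      by (metis abs_ge_self bd mult.commute mult_left_mono norm_blinfun norm_ge_zero order_trans real_norm_def)
  qed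
  have "\<exists>s. \<forall>k. ?P k (s k) \<and> ?Q k (s k) (s (Suc k))"
  proof (rule dependent_nat_choice)
    have "0 < d / 4" using d by simp
    moreover have "\<forall>n\<in>I. d \<le> h n x" using I(2) by blast
    ultimately have "\<exists>j z J. j \<in> I \<and> 0 \<le> z \<and> z \<le> x \<and> d - d/4 \<le> h j z \<and> infinite J \<and>
      J \<subseteq> I \<inter> {j<..} \<and> (\<forall>n\<in>J. d - d/4 \<le> h n (x - z))"
      by (rule step[OF x _ I(1)])
    then obtain j z J where
      "j \<in> I" "0 \<le> z" "z \<le> x" "d - d/4 \<le> h j z" "infinite J" "J \<subseteq> I \<inter> {j<..}" "\<forall>n\<in>J. d - d/4 \<le> h n (x - z)"
      by (elim exE conjE) (rule that)
    moreover from this have "c 0 \<le> h j z" "\<forall>n\<in>J. c 0 \<le> h n (x - z)"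
      unfolding c(1) by simp_all
    ultimately have "?P 0 (j, z, x - z, J)" by auto
    then show "\<exists>s. ?P 0 s" by blast
  next
    fix s k assume "?P k s"
    moreover obtain j z y J where [simp]: "s = (j, z, y, J)" by (cases s)
    ultimately have s: "0 \<le> y" "infinite J" "J \<subseteq> {j<..}" "\<forall>n\<in>J. c k \<le> h n y" by auto
    from step[OF s(1) c(3)[of k] s(2,4)] obtain j' z' J' where s': "j' \<in> J" "0 \<le> z'" "z' \<le> y" "c (Suc k) \<le> h j' z'"
      "infinite J'" "J' \<subseteq> J \<inter> {j'<..}" "\<forall>n\<in>J'. c (Suc k) \<le> h n (y - z')"
      unfolding c(2) by (elim exE conjE) (rule that)
    then have "?P (Suc k) (j', z', y - z', J')" by auto
    moreover have "?Q k s (j', z', y - z', J')" using s' s by auto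
    ultimately show "\<exists>s'. ?P (Suc k) s' \<and> ?Q k s s'" by blast
  qed
  then obtain s where s: "\<forall>k. ?P k (s k) \<and> ?Q k (s k) (s (Suc k))" ..
  define r where "r k = fst (s k)" for k
  define z where "z k = fst (snd (s k))" for k
  define y where "y k = fst (snd (snd (s k)))" for k
  have P: "0 \<le> z k" "0 \<le> y k" "c k \<le> h (r k) (z k)" "y 0 = x - z 0" for k
    using s[rule_format, of k] s[rule_format, of 0] by (simp_all add: r_def z_def y_def case_prod_beta)
  have Q: "r k < r (Suc k)" "y (Suc k) = y k - z (Suc k)" for k
    using s[rule_format, of k] by (simp_all add: r_def z_def y_def case_prod_beta)
  have "sum z {..k} + y k = x" for k
    by (induction k) (simp_all add: P Q)
  then have "sum z {..k} \<le> x" for k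
    using P(2)[of k] by (metis add_le_cancel_left add.right_neutral)
  then have "sum z {..<k} \<le> x" for k
    using x by (cases k) (auto simp: lessThan_Suc_atMost)
  moreover have "strict_mono r" using Q(1) by (simp add: strict_mono_Suc_iff)
  moreover have "d / 2 \<le> h (r k) (z k)" for k using c(4)[of k] P(3)[of k] by linarith
  ultimately show ?thesis using P(1) by (auto intro!: exI[of _ r] exI[of _ z])
qed

section \<open>Boundedness and cluster points\<close>

lemma norm_blinfun_le_on_ball:
  fixes f :: "'a::real_normed_vector \<Rightarrow>\<^sub>L 'b::real_normed_vector"
  assumes r: "0 < r" and b: "\<And>x. norm x \<le> r \<Longrightarrow> norm (f x) \<le> b"
  shows "norm f \<le> b / r"
proof (rule norm_blinfun_bound)
  have "0 \<le> b" using b[of 0] r by simp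
  then show "0 \<le> b / r" using r by simp
  fix x :: 'a
  show "norm (f x) \<le> b / r * norm x"
  proof (cases "x = 0")
    case False
    have "norm (f ((r / norm x) *\<^sub>R x)) \<le> b" using False r by (intro b) simp
    then show ?thesis using False r by (simp add: blinfun.scaleR_right field_simps)
  qed simp
qed

text \<open>
  The Banach--Steinhaus theorem for sequences: by Baire, some set of uniform boundedness contains a ball.
\<close>

lemma uniform_boundedness:
  fixes f :: "nat \<Rightarrow> 'a::banach \<Rightarrow>\<^sub>L 'b::real_normed_vector"
  assumes bd: "\<And>x. Bseq (\<lambda>n. f n x)"
  shows "\<exists>B. \<forall>n. norm (f n) \<le> B"
proof -
  define K where "K m = {x. \<forall>n. norm (f n x) \<le> real m}" for m
  have closed_K: "closed (K m)" for m
    unfolding K_def by (intro closed_Collect_all closed_Collect_le continuous_intros)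
  have "x \<in> (\<Union>m. K m)" for x
  proof -
    obtain B where B: "\<forall>n. norm (f n x) \<le> B" using bd[of x] unfolding Bseq_def by blast
    obtain m :: nat where "B \<le> real m" using real_arch_simple by blast
    with B have "x \<in> K m" by (auto simp: K_def intro: order_trans)
    then show ?thesis by blast
  qed
  then have UN: "(\<Union>m. K m) = UNIV" by blast
  have "\<exists>m. interior (K m) \<noteq> {}"
  proof (rule ccontr)
    assume "\<not> ?thesis"
    then have "interior (\<Union>(range K)) = {}"
      using Met_TC.metric_Baire_category_alt[of "range K"] closed_K
      by (auto simp: complete_UNIV)
    then show False using UN by simp
  qed
  then obtain m x0 where "x0 \<in> interior (K m)" by blast
  then obtain r where r: "0 < r" "cball x0 r \<subseteq> K m" by (auto simp: mem_interior_cball)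
  have "norm (f n) \<le> 2 * real m / r" for n
  proof (rule norm_blinfun_le_on_ball[OF r(1)])
    fix x :: 'a assume "norm x \<le> r"
    then have "x0 + x \<in> K m" "x0 \<in> K m" using r by (auto simp: dist_norm)
    then have "norm (f n (x0 + x)) \<le> m" "norm (f n x0) \<le> m" by (auto simp: K_def)
    moreover have "f n x = f n (x0 + x) - f n x0" by (simp add: blinfun.add_right)
    ultimately show "norm (f n x) \<le> 2 * real m"
      using norm_triangle_ineq4[of "f n (x0 + x)" "f n x0"] by simp
  qed
  then show ?thesis by blast
qed

text \<open>
  Weak and weak* compactness need not give convergent subsequences, so cluster points are expressed as
  limits along a filter finer than \<^const>\<open>sequentially\<close>.
\<close>

lemma compact_cluster_filter:
  fixes u :: "nat \<Rightarrow> 'a::topological_space"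
  assumes K: "compact K" and u: "\<And>n. u n \<in> K"
  shows "\<exists>l\<in>K. \<exists>F. F \<noteq> bot \<and> F \<le> sequentially \<and> (u \<longlongrightarrow> l) F"
proof -
  let ?G = "filtermap u sequentially"
  have "?G \<noteq> bot" "eventually (\<lambda>x. x \<in> K) ?G"
    using u by (simp_all add: filtermap_bot_iff eventually_filtermap)
  then obtain l where l: "l \<in> K" "inf (nhds l) ?G \<noteq> bot"
    using K unfolding compact_filter by blast
  define F where "F = inf sequentially (filtercomap u (nhds l))"
  have "F \<noteq> bot"
  proof
    assume "F = bot"
    then have "eventually (\<lambda>_. False) F" by simp
    then obtain P R where PR: "eventually P sequentially" "eventually R (nhds l)"
      "\<And>n. P n \<Longrightarrow> R (u n) \<Longrightarrow> False"
      unfolding F_def eventually_inf eventually_filtercomap by blast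
    have "eventually (\<lambda>n. \<not> R (u n)) sequentially"
      using PR(1) by (rule eventually_mono) (use PR(3) in blast)
    with PR(2) have "eventually (\<lambda>_. False) (inf (nhds l) ?G)"
      unfolding eventually_inf eventually_filtermap
      by (intro exI[of _ R] exI[of _ "\<lambda>x. \<not> R x"]) simp
    with l(2) show False by (simp add: eventually_False)
  qed
  moreover have "(u \<longlongrightarrow> l) F"
    unfolding filterlim_iff_le_filtercomap F_def by simp
  ultimately show ?thesis using l(1) unfolding F_def by (meson inf.cobounded1)
qed

text \<open>
  The sequential content of the Banach--Alaoglu theorem, from Tychonoff's theorem: the functionals lie in
  a product of compact intervals, and linearity and the bound pass to pointwise limits.
\<close>

lemma weak_star_cluster:
  fixes g :: "nat \<Rightarrow> 'a::real_normed_vector \<Rightarrow>\<^sub>L real"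
  assumes g: "\<And>n. norm (g n) \<le> M"
  shows "\<exists>(l :: 'a \<Rightarrow>\<^sub>L real) F. F \<noteq> bot \<and> F \<le> sequentially \<and> (\<forall>x. ((\<lambda>n. g n x) \<longlongrightarrow> l x) F)"
proof -
  define K where "K = PiE UNIV (\<lambda>x::'a. {- (M * norm x)..M * norm x})"
  have "compact K"
    unfolding K_def compactin_euclidean_iff[symmetric] euclidean_product_topology[symmetric]
    by (subst compactin_PiE) simp
  moreover have "blinfun_apply (g n) \<in> K" for n
  proof -
    have "\<bar>g n x\<bar> \<le> M * norm x" for x
      using norm_blinfun[of "g n" x] mult_right_mono[OF g[of n] norm_ge_zero[of x]] by simp
    then show ?thesis by (auto simp: K_def abs_le_iff minus_le_iff)
  qed
  ultimately have "\<exists>p\<in>K. \<exists>F. F \<noteq> bot \<and> F \<le> sequentially \<and> ((\<lambda>n. blinfun_apply (g n)) \<longlongrightarrow> p) F"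
    by (rule compact_cluster_filter)
  then obtain p F where p: "p \<in> K" and F: "F \<noteq> bot" "F \<le> sequentially"
    and lim: "((\<lambda>n. blinfun_apply (g n)) \<longlongrightarrow> p) F"
    by (elim bexE exE conjE)
  have lim: "((\<lambda>n. g n x) \<longlongrightarrow> p x) F" for x
    using lim by (simp add: tendsto_pointwise_iff)
  have "bounded_linear p"
  proof (rule bounded_linear_intro)
    fix x y :: 'a and c :: real
    show "p (x + y) = p x + p y"
      using tendsto_unique[OF F(1) lim tendsto_add[OF lim lim, of x y, folded blinfun.add_right]] .
    show "p (c *\<^sub>R x) = c *\<^sub>R p x"
      using tendsto_unique[OF F(1) lim tendsto_scaleR[OF tendsto_const lim, of c x, folded blinfun.scaleR_right]] .
    show "norm (p x) \<le> norm x * M" using p by (auto simp: K_def PiE_iff abs_le_iff mult.commute minus_le_iff)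
  qed
  then have "blinfun_apply (Blinfun p) = p" by (rule bounded_linear_Blinfun_apply)
  then show ?thesis using F lim by (intro exI[of _ "Blinfun p"]) auto
qed

lemma weak_cluster:
  fixes u :: "nat \<Rightarrow> 'a::real_normed_vector"
  assumes A: "relatively_weakly_compact A" and u: "\<And>n. u n \<in> A"
  shows "\<exists>l F. F \<noteq> bot \<and> F \<le> sequentially \<and> (\<forall>f :: 'a \<Rightarrow>\<^sub>L real. ((\<lambda>n. f (u n)) \<longlongrightarrow> f l) F)"
proof -
  let ?ev = "\<lambda>x f. blinfun_apply (f :: 'a \<Rightarrow>\<^sub>L real) x"
  let ?K = "weak_topology closure_of A"
  have top: "topspace (weak_topology :: 'a topology) = UNIV"
    by (simp add: weak_topology_def topspace_pullback_topology)
  have cont: "continuous_map weak_topology euclidean ?ev"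
    unfolding weak_topology_def
    using continuous_map_pullback[OF continuous_map_id, of UNIV ?ev] by simp
  have "compact (?ev ` ?K)"
    using image_compactin[OF A[unfolded relatively_weakly_compact_def] cont] by simp
  moreover have "?ev (u n) \<in> ?ev ` ?K" for n
    using u closure_of_subset[of A weak_topology] by (auto simp: top)
  ultimately have "\<exists>p \<in> ?ev ` ?K. \<exists>F. F \<noteq> bot \<and> F \<le> sequentially \<and> ((\<lambda>n. ?ev (u n)) \<longlongrightarrow> p) F"
    by (rule compact_cluster_filter)
  then obtain p F where p: "p \<in> ?ev ` ?K" and F: "F \<noteq> bot" "F \<le> sequentially"
    and lim: "((\<lambda>n. ?ev (u n)) \<longlongrightarrow> p) F" by (elim bexE exE conjE)
  from p obtain l where "p = ?ev l" by (rule imageE)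
  with lim have "\<forall>f. ((\<lambda>n. ?ev (u n) f) \<longlongrightarrow> ?ev l f) F"
    by (simp add: tendsto_pointwise_iff)
  then show ?thesis by (intro exI[of _ l] exI[of _ F]) (simp add: F)
qed

section \<open>Order weakly compact operators\<close>

lemma functional_summable_abs:
  fixes f :: "'a::banach_lattice \<Rightarrow>\<^sub>L real"
  assumes z: "\<And>j. 0 \<le> z j" and sum_z: "\<And>j. sum z {..<j} \<le> x"
  shows "summable (\<lambda>j. \<bar>f (z j)\<bar>)"
proof (rule summableI_nonneg_bounded)
  fix n
  have "(\<Sum>j<n. \<bar>f (z j)\<bar>) \<le> (\<Sum>j<n. \<bar>f\<bar> (z j))"
    by (intro sum_mono blinfun_abs_le_nonneg z)
  also have "\<dots> = \<bar>f\<bar> (sum z {..<n})" by (simp add: blinfun.sum_right)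
  also have "\<dots> \<le> \<bar>f\<bar> x" by (intro blinfun_mono sum_z) simp
  finally show "(\<Sum>j<n. \<bar>f (z j)\<bar>) \<le> \<bar>f\<bar> x" .
qed simp

lemma functional_tendsto_0:
  fixes f :: "'a::banach_lattice \<Rightarrow>\<^sub>L real"
  assumes "\<And>j. 0 \<le> z j" "\<And>j. sum z {..<j} \<le> x"
  shows "(\<lambda>j. f (z j)) \<longlonglongrightarrow> 0"
  using summable_LIMSEQ_zero[OF functional_summable_abs[OF assms]] by (simp add: tendsto_rabs_zero_iff)

text \<open>
  A double limit argument: a weak cluster point in the range is tested against a weak* cluster point of
  the functionals. Suppose that all \<open>\<bar>g j (T (z j))\<bar>\<close> are at least \<open>d\<close>, let \<open>l\<close> be a weak* cluster point of \<open>g\<close> and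
  put \<open>a n k = (g n - l) (T (z k))\<close>. The rows of this matrix tend to \<open>0\<close>, its columns cluster at \<open>0\<close>, and
  its diagonal stays away from \<open>0\<close>. A gliding hump picks indices \<open>r j\<close> for which the off-diagonal
  entries are negligible. With \<open>s\<close> a weak cluster point of the partial sums of the \<open>T (z (r k))\<close>, each
  \<open>(g (r j) - l) s\<close> is the sum of the \<open>j\<close>-th row, hence at least \<open>d / 4\<close> in modulus. But a weak* cluster
  point \<open>l'\<close> of the functionals \<open>g (r j) - l\<close> vanishes at every \<open>T (z (r k))\<close>, and so at \<open>s\<close>.
\<close>

lemma order_weakly_compact_diagonal:
  fixes T :: "'e::banach_lattice \<Rightarrow>\<^sub>L 'x::banach" and g :: "nat \<Rightarrow> 'x \<Rightarrow>\<^sub>L real"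
  assumes T: "order_weakly_compact T" and z: "\<And>j. 0 \<le> z j" and sum_z: "\<And>j. sum z {..<j} \<le> x"
    and g: "\<And>j. norm (g j) \<le> 1" and d: "0 < d"
  shows "\<exists>j. \<bar>g j (T (z j))\<bar> < d"
proof (rule ccontr)
  assume "\<not> ?thesis"
  then have g_z: "d \<le> \<bar>g j (T (z j))\<bar>" for j by (simp add: not_less)
  have x: "0 \<le> x" using sum_z[of 0] by simp
  have f_z: "(\<lambda>k. f (T (z k))) \<longlonglongrightarrow> 0" for f :: "'x \<Rightarrow>\<^sub>L real"
    using functional_tendsto_0[OF z sum_z, of "banach_adjoint T f"] by (simp add: banach_adjoint_apply)
  obtain l F where F: "F \<noteq> bot" "F \<le> sequentially"
    and l: "\<And>y. ((\<lambda>n. g n y) \<longlongrightarrow> blinfun_apply l y) F"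
    using weak_star_cluster[of g, OF g] by (elim exE conjE) (rule that, auto)
  define a where "a n k = (g n - l) (T (z k))" for n k
  have col: "((\<lambda>n. a n k) \<longlongrightarrow> 0) F" for k
    using tendsto_diff[OF l[of "T (z k)"] tendsto_const[of "l (T (z k))"]]
    by (simp add: a_def blinfun.diff_left)
  have row: "(\<lambda>k. a n k) \<longlonglongrightarrow> 0" for n
    using f_z[of "g n - l"] by (simp add: a_def)
  have "eventually (\<lambda>n. \<bar>l (T (z n))\<bar> < d / 2) sequentially"
    using tendstoD[OF f_z[of l], of "d / 2"] d by (simp add: dist_real_def)
  then have diag: "eventually (\<lambda>n. d / 2 \<le> \<bar>a n n\<bar>) sequentially"
  proof (rule eventually_mono)
    fix n assume "\<bar>l (T (z n))\<bar> < d / 2"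
    with g_z[of n] show "d / 2 \<le> \<bar>a n n\<bar>" unfolding a_def blinfun.diff_left by linarith
  qed
  \<comment> \<open>The sum of all \<open>?e k\<close> is \<open>d / 8\<close>, which leaves \<open>3 * d / 8\<close> of the diagonal entry \<open>d / 2\<close>.\<close>
  let ?e = "\<lambda>j::nat. d / 16 / 2 ^ j"
  have e: "0 < ?e j" for j using d by simp
  let ?P = "\<lambda>(j::nat) n. d / 2 \<le> \<bar>a n n\<bar>"
  \<comment> \<open>Controlling all indices up to \<open>n\<close>, chosen or not, makes each choice depend on the previous one only.\<close>
  let ?Q = "\<lambda>j n n'. n < n' \<and> (\<forall>k\<in>{..n}. \<bar>a n' k\<bar> < ?e (Suc j) \<and> \<bar>a k n'\<bar> < ?e (Suc j))"
  have "\<exists>r. \<forall>j. ?P j (r j) \<and> ?Q j (r j) (r (Suc j))"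
  proof (rule dependent_nat_choice)
    show "\<exists>n. d / 2 \<le> \<bar>a n n\<bar>" using eventually_happens'[OF sequentially_bot diag] by blast
    fix n j
    have "eventually (\<lambda>n'. \<bar>a n' k\<bar> < ?e (Suc j)) F" for k
      using tendstoD[OF col e[of "Suc j"], of k] by (simp add: dist_real_def)
    moreover have "eventually (\<lambda>n'. \<bar>a k n'\<bar> < ?e (Suc j)) F" for k
      using filter_leD[OF F(2) tendstoD[OF row e[of "Suc j"]], of k] by (simp add: dist_real_def)
    ultimately have "eventually (\<lambda>n'. \<forall>k\<in>{..n}. \<bar>a n' k\<bar> < ?e (Suc j) \<and> \<bar>a k n'\<bar> < ?e (Suc j)) F"
      by (intro eventually_ball_finite ballI eventually_conj) auto
    moreover have "eventually (\<lambda>n'. d / 2 \<le> \<bar>a n' n'\<bar> \<and> n < n') F"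
      by (rule filter_leD[OF F(2)], intro eventually_conj diag eventually_gt_at_top)
    ultimately have "eventually (\<lambda>n'. ?P (Suc j) n' \<and> ?Q j n n') F"
      by eventually_elim auto
    then show "\<exists>n'. ?P (Suc j) n' \<and> ?Q j n n'" by (rule eventually_happens'[OF F(1)])
  qed
  then obtain r where r: "\<forall>j. ?P j (r j) \<and> ?Q j (r j) (r (Suc j))" ..
  have mono: "strict_mono r" using r by (simp add: strict_mono_Suc_iff)
  have off: "\<bar>a (r j) (r k)\<bar> \<le> ?e j" "\<bar>a (r k) (r j)\<bar> \<le> ?e j" if kj: "k < j" for j k
  proof -
    obtain i where i: "j = Suc i" using kj by (cases j) auto
    have "r k \<le> r i" using kj i mono by (simp add: strict_mono_less_eq)
    with r[rule_format, of i] show "\<bar>a (r j) (r k)\<bar> \<le> ?e j" "\<bar>a (r k) (r j)\<bar> \<le> ?e j"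
      unfolding i by (auto simp: less_imp_le)
  qed
  \<comment> \<open>The bound must be summable in \<open>k\<close> for fixed \<open>j\<close>; if \<open>k < j\<close>, it is weaker than the one just obtained.\<close>
  have off': "\<bar>a (r j) (r k)\<bar> \<le> ?e k" if "k \<noteq> j" for j k
  proof (cases "k < j")
    case True
    then have "?e j \<le> ?e k" using d by (intro divide_left_mono power_increasing) auto
    with off(1)[OF True] show ?thesis by linarith
  next
    case False
    with that off(2)[of j k] show ?thesis by simp
  qed
  define w where "w m = (\<Sum>k<m. z (r k))" for m
  have w: "w m \<in> {0..x}" for m
  proof -
    have "w m = sum z (r ` {..<m})"
      unfolding w_def using mono by (subst sum.reindex) (auto intro: strict_mono_imp_inj_on)
    also have "\<dots> \<le> sum z {..<r m}"
      using mono z by (intro sum_mono2) (auto simp: strict_mono_less)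
    also have "\<dots> \<le> x" by (rule sum_z)
    finally show ?thesis using z by (auto simp: w_def sum_nonneg)
  qed
  have "relatively_weakly_compact (T ` {0..x})"
    using T x by (simp add: order_weakly_compact_def)
  from weak_cluster[OF this, of "\<lambda>m. T (w m)"] w
  obtain s G where G: "G \<noteq> bot" "G \<le> sequentially"
    and s: "\<And>f :: 'x \<Rightarrow>\<^sub>L real. ((\<lambda>m. f (T (w m))) \<longlongrightarrow> f s) G"
    by auto
  have g_w: "(g (r j) - l) (T (w m)) = (\<Sum>k<m. a (r j) (r k))" for j m
    by (simp add: w_def a_def blinfun.sum_right)
  have lower: "d / 4 \<le> \<bar>(g (r j) - l) s\<bar>" for j
  proof (rule tendsto_lowerbound[OF tendsto_rabs[OF s] _ G(1)])
    have "d / 4 \<le> \<bar>(g (r j) - l) (T (w m))\<bar>" if m: "j < m" for m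
    proof -
      have "(\<Sum>k<m. a (r j) (r k)) = a (r j) (r j) + (\<Sum>k\<in>{..<m} - {j}. a (r j) (r k))"
        using m by (subst sum.remove[of _ j]) auto
      moreover have "\<bar>\<Sum>k\<in>{..<m} - {j}. a (r j) (r k)\<bar> \<le> (\<Sum>k\<in>{..<m} - {j}. ?e k)"
        by (intro order_trans[OF sum_abs] sum_mono off') auto
      moreover have "(\<Sum>k\<in>{..<m} - {j}. ?e k) \<le> (\<Sum>k<m. ?e k)"
        using d by (intro sum_mono2) auto
      moreover have "(\<Sum>k<m. ?e k) \<le> d / 8"
      proof -
        have "(\<Sum>k<m. ?e k) = d / 16 * (\<Sum>k<m. (1 / 2) ^ k)"
          by (simp add: sum_distrib_left power_one_over)
        also have "(\<Sum>k<m. (1 / 2 :: real) ^ k) \<le> 2"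
          by (subst sum_gp_strict) simp
        finally show ?thesis using d by simp
      qed
      moreover have "d / 2 \<le> \<bar>a (r j) (r j)\<bar>" using r by blast
      ultimately show ?thesis unfolding g_w using d by linarith
    qed
    then show "eventually (\<lambda>m. d / 4 \<le> \<bar>(g (r j) - l) (T (w m))\<bar>) G"
      by (intro filter_leD[OF G(2)] eventually_mono[OF eventually_gt_at_top[of j]])
  qed
  have "norm l \<le> 1"
  proof (rule norm_blinfun_bound)
    fix y show "norm (l y) \<le> 1 * norm y"
    proof (rule tendsto_upperbound[OF tendsto_norm[OF l] _ F(1)])
      show "eventually (\<lambda>n. norm (g n y) \<le> 1 * norm y) F"
        using norm_blinfun[of "g _" y] mult_right_mono[OF g norm_ge_zero[of y]]
        by (intro always_eventually allI) (meson order_trans)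
    qed
  qed simp
  then have "norm (g (r j) - l) \<le> 2" for j
    using norm_triangle_ineq4[of "g (r j)" l] g[of "r j"] by linarith
  from weak_star_cluster[of "\<lambda>j. g (r j) - l", OF this]
  obtain l' F' where F': "F' \<noteq> bot" "F' \<le> sequentially"
    and l': "\<And>y. ((\<lambda>j. (g (r j) - l) y) \<longlongrightarrow> blinfun_apply l' y) F'"
    by (elim exE conjE) (rule that, auto)
  have "l' (T (z (r k))) = 0" for k
  proof (rule tendsto_unique[OF F'(1) l'])
    have "(\<lambda>j. a (r j) (r k)) \<longlonglongrightarrow> 0"
    proof (rule tendsto_rabs_zero_cancel[OF tendsto_sandwich[OF _ _ tendsto_const]])
      show "eventually (\<lambda>j. \<bar>a (r j) (r k)\<bar> \<le> d / 16 * (1 / 2) ^ j) sequentially"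
        using off(1) by (intro eventually_mono[OF eventually_gt_at_top[of k]]) (simp add: power_one_over)
      show "(\<lambda>j. d / 16 * (1 / 2) ^ j) \<longlonglongrightarrow> 0"
        by (rule tendsto_mult_right_zero[OF LIMSEQ_power_zero]) simp
    qed simp
    then show "((\<lambda>j. (g (r j) - l) (T (z (r k)))) \<longlongrightarrow> 0) F'"
      using F'(2) by (auto simp: a_def intro: tendsto_mono)
  qed
  then have "l' (T (w m)) = 0" for m by (simp add: w_def blinfun.sum_right)
  then have "l' s = 0" using tendsto_unique[OF G(1) s[of l']] by simp
  moreover have "d / 4 \<le> \<bar>l' s\<bar>"
    by (rule tendsto_lowerbound[OF tendsto_rabs[OF l'] _ F'(1)]) (intro always_eventually allI lower)
  ultimately show False using d by simp
qed

lemma not_tendsto_0_infinite: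
  fixes u :: "nat \<Rightarrow> real"
  assumes "\<not> u \<longlonglongrightarrow> 0" "\<And>n. 0 \<le> u n"
  shows "\<exists>d>0. infinite {n. d \<le> u n}"
proof -
  obtain d where d: "0 < d" "\<not> eventually (\<lambda>n. dist (u n) 0 < d) sequentially"
    using assms(1) unfolding tendsto_iff by blast
  then have "infinite {n. \<not> u n < d}"
    using assms(2) by (simp add: cofinite_eq_sequentially[symmetric] eventually_cofinite)
  then show ?thesis using d(1) by (auto simp: not_less)
qed

text \<open>
  Otherwise \<open>x\<close> contains summable pieces on which the \<open>h n\<close>, and so the moduli of the adjoint
  functionals, are large. Inside each piece lies an element at which the adjoint functional itself is
  large, contrary to the previous result on \<open>T\<close>.
\<close>

lemma order_weakly_compact_disjoint_tendsto_0:
  fixes T :: "'e::banach_lattice \<Rightarrow>\<^sub>L 'x::banach" and g :: "nat \<Rightarrow> 'x \<Rightarrow>\<^sub>L real"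
  assumes T: "order_weakly_compact T" and g: "\<And>n. norm (g n) \<le> 1"
    and h: "\<And>n. 0 \<le> h n" "\<And>n. h n \<le> \<bar>banach_adjoint T (g n)\<bar>"
    and disj: "\<And>m n. m \<noteq> n \<Longrightarrow> inf (h m) (h n) = 0" and x: "0 \<le> x"
  shows "(\<lambda>n. h n x) \<longlonglongrightarrow> 0"
proof (rule ccontr)
  assume "\<not> ?thesis"
  then obtain d where d: "0 < d" "infinite {n. d \<le> h n x}"
    using not_tendsto_0_infinite[of "\<lambda>n. h n x"] blinfun_nonneg[OF h(1) x] by blast
  let ?f = "\<lambda>n. banach_adjoint T (g n)"
  have bd: "norm (h n) \<le> norm (banach_adjoint T)" for n
  proof -
    have "norm (h n) \<le> norm (?f n)"
      using norm_mono_nonneg[OF h] by (simp add: norm_abs_eq)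
    also have "\<dots> \<le> norm (banach_adjoint T) * norm (g n)" by (rule norm_blinfun)
    also have "\<dots> \<le> norm (banach_adjoint T)" using g[of n] by (simp add: mult_left_le)
    finally show ?thesis .
  qed
  have "\<exists>(r :: nat \<Rightarrow> nat) z. strict_mono r \<and> (\<forall>j. 0 \<le> z j) \<and> (\<forall>j. sum z {..<j} \<le> x) \<and>
    (\<forall>j. d / 2 \<le> h (r j) (z j))"
    by (rule disjoint_functionals_witnesses[OF h(1) disj bd x d]) auto
  then obtain r :: "nat \<Rightarrow> nat" and z where "\<forall>j. 0 \<le> z j" "\<forall>j. sum z {..<j} \<le> x"
    "\<forall>j. d / 2 \<le> h (r j) (z j)" by (elim exE conjE) (rule that)
  then have z: "\<And>j. 0 \<le> z j" "\<And>j. sum z {..<j} \<le> x" "\<And>j. d / 2 \<le> h (r j) (z j)"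
    by blast+
  have "\<exists>y. 0 \<le> y \<and> y \<le> z j \<and> d / 8 \<le> \<bar>?f (r j) y\<bar>" for j
  proof (rule ccontr)
    assume "\<not> ?thesis"
    then have "\<bar>?f (r j)\<bar> (z j) \<le> 3 * (d / 8)"
      by (intro blinfun_abs_apply_le z) (meson linear)
    moreover have "h (r j) (z j) \<le> \<bar>?f (r j)\<bar> (z j)"
      using h(2) z(1) by (simp add: less_eq_blinfun_def)
    ultimately show False using z(3)[of j] d(1) by linarith
  qed
  then have "\<forall>j. \<exists>y. 0 \<le> y \<and> y \<le> z j \<and> d / 8 \<le> \<bar>?f (r j) y\<bar>" by blast
  then obtain y where y: "\<And>j. 0 \<le> y j" "\<And>j. y j \<le> z j" "\<And>j. d / 8 \<le> \<bar>?f (r j) (y j)\<bar>"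
    unfolding choice_iff by blast
  have "sum y {..<j} \<le> x" for j using sum_mono[of "{..<j}" y z] y(2) z(2)[of j] order_trans by blast
  from order_weakly_compact_diagonal[OF T y(1) this, of "\<lambda>j. g (r j)" "d / 8"] g d(1) y(3)
  show False by (force simp: banach_adjoint_apply not_less[symmetric])
qed

section \<open>Almost order boundedness\<close>

text \<open>
  The positive cone is closed because \<open>(- x)\<^sup>+ \<le> \<bar>u n - x\<bar>\<close> whenever \<open>u n \<ge> 0\<close>.
\<close>

lemma nonneg_if_LIMSEQ_nonneg:
  fixes x :: "'a::banach_lattice"
  assumes lim: "u \<longlonglongrightarrow> x" and u: "\<And>n. 0 \<le> u n"
  shows "0 \<le> x"
proof -
  have "norm (pprt (- x)) \<le> norm (u n - x)" for n
  proof (rule norm_mono_abs)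
    have "- x \<le> u n - x" using u[of n] by simp
    also have "\<dots> \<le> \<bar>u n - x\<bar>" by (rule abs_ge_self)
    finally show "\<bar>pprt (- x)\<bar> \<le> \<bar>u n - x\<bar>" by (simp add: pprt_def)
  qed
  moreover have "(\<lambda>n. norm (u n - x)) \<longlonglongrightarrow> 0"
    using lim by (simp add: LIM_zero_iff tendsto_norm_zero)
  ultimately have "norm (pprt (- x)) \<le> 0"
    by (intro tendsto_lowerbound[OF _ always_eventually sequentially_bot]) auto
  then have "pprt (- x) = 0" by simp
  then show ?thesis by (simp add: le_zero_iff_zero_pprt[symmetric])
qed

lemma term_le_suminf:
  fixes f :: "nat \<Rightarrow> 'a::banach_lattice"
  assumes f: "summable f" "\<And>n. 0 \<le> f n"
  shows "f k \<le> suminf f"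
proof -
  have "(\<lambda>n. sum f {..<n + Suc k} - f k) \<longlonglongrightarrow> suminf f - f k"
    by (intro tendsto_diff tendsto_const LIMSEQ_ignore_initial_segment summable_LIMSEQ f)
  moreover have "0 \<le> sum f {..<n + Suc k} - f k" for n
    by (subst sum.remove[of _ k]) (auto intro!: sum_nonneg f)
  ultimately have "0 \<le> suminf f - f k" by (rule nonneg_if_LIMSEQ_nonneg)
  then show ?thesis by simp
qed

lemma inf_pprt_pprt_minus:
  fixes a :: "'a::lattice_ab_group_add"
  shows "inf (pprt a) (pprt (- a)) = 0"
proof -
  have "a + pprt (- a) = pprt a"
    using arg_cong[OF prts[of a], of "\<lambda>x. x - nprt a"] by (simp add: pprt_neg)
  then have "inf (pprt a) (pprt (- a)) = inf (a + pprt (- a)) (0 + pprt (- a))" by simp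
  also have "\<dots> = nprt a + pprt (- a)"
    by (simp only: add_inf_distrib_right[symmetric] nprt_def)
  finally show ?thesis by (simp add: pprt_neg)
qed

lemma norm_pprt_le_diff:
  fixes a b :: "'a::banach_lattice"
  assumes "0 \<le> b"
  shows "norm (pprt a) \<le> norm (pprt (a - b)) + norm b"
proof -
  have "a - b \<le> pprt (a - b)" by (simp add: pprt_def)
  then have "pprt a \<le> pprt (a - b) + b"
    using assms by (simp add: pprt_def[of a] add_nonneg_nonneg diff_le_eq)
  then have "norm (pprt a) \<le> norm (pprt (a - b) + b)" by (intro norm_mono_nonneg) auto
  then show ?thesis using norm_triangle_ineq order_trans by blast
qed

text \<open>
  If no \<open>u\<close> works, elements \<open>f n\<close> of \<open>S\<close> can be chosen with \<open>(f n - 4 ^ n t n)\<^sup>+\<close> of norm above \<open>e\<close>,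
  where \<open>t n\<close> is the sum of the earlier ones. The elements
  \<open>h n = (f n - 4 ^ n t n - 2 ^ (- n) w)\<^sup>+\<close> with \<open>w = (\<Sum>k. 2 ^ (- k) f k)\<close> are then disjoint: for
  \<open>m < n\<close> put \<open>a = f n - 4 ^ n f m\<close>; subtracting \<open>4 ^ n t n\<close> gives \<open>h n \<le> a\<^sup>+\<close>, and subtracting
  \<open>2 ^ (- m) w\<close>, which dominates \<open>4 ^ (- n) f n\<close>, gives \<open>h m \<le> (- a)\<^sup>+\<close>. As \<open>2 ^ (- n) w\<close> tends to \<open>0\<close>,
  the norms of the \<open>h n\<close> stay away from \<open>0\<close>.
\<close>

lemma almost_order_bounded_if_disjoint_null:
  fixes S :: "'a::banach_lattice set"
  assumes S: "\<And>s. s \<in> S \<Longrightarrow> 0 \<le> s" "\<And>s. s \<in> S \<Longrightarrow> norm s \<le> M"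
    and null: "\<And>f h. (\<And>n. f n \<in> S) \<Longrightarrow> (\<And>n. 0 \<le> h n) \<Longrightarrow> (\<And>n. h n \<le> f n) \<Longrightarrow>
      (\<And>m n. m \<noteq> n \<Longrightarrow> inf (h m) (h n) = 0) \<Longrightarrow> h \<longlonglongrightarrow> 0"
    and e: "0 < e"
  shows "\<exists>u\<ge>0. \<forall>s\<in>S. norm (pprt (s - u)) \<le> e"
proof (rule ccontr)
  assume "\<not> ?thesis"
  then have ex: "\<exists>s\<in>S. e < norm (pprt (s - u))" if "0 \<le> u" for u
    using that by (auto simp: not_le)
  \<comment> \<open>A state is a pair of the element chosen last and the sum of those chosen before it.\<close>
  let ?P = "\<lambda>n (s, t). s \<in> S \<and> 0 \<le> t \<and> e < norm (pprt (s - 4 ^ n *\<^sub>R t))"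
  have "\<exists>p. \<forall>n::nat. ?P n (p n) \<and> snd (p (Suc n)) = snd (p n) + fst (p n)"
  proof (rule dependent_nat_choice)
    obtain s where "s \<in> S" "e < norm (pprt (s - 0))" using ex[of 0] by auto
    then show "\<exists>p. ?P 0 p" by (intro exI[of _ "(s, 0)"]) simp
  next
    fix p and n :: nat assume "?P n p"
    then have p: "0 \<le> snd p + fst p" using S(1) by (auto split: prod.splits)
    obtain s where "s \<in> S" "e < norm (pprt (s - 4 ^ Suc n *\<^sub>R (snd p + fst p)))"
      using ex[OF scaleR_nonneg_nonneg[OF _ p], of "4 ^ Suc n"] by auto
    with p show "\<exists>q. ?P (Suc n) q \<and> snd q = snd p + fst p"
      by (intro exI[of _ "(s, snd p + fst p)"]) simp
  qed
  then obtain p where p: "\<forall>n. ?P n (p n) \<and> snd (p (Suc n)) = snd (p n) + fst (p n)" ..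
  define f where "f n = fst (p n)" for n
  define t where "t n = snd (p n)" for n
  have f: "f n \<in> S" "0 \<le> f n" "norm (f n) \<le> M" and t: "0 \<le> t n" "t (Suc n) = t n + f n"
    and far: "e < norm (pprt (f n - 4 ^ n *\<^sub>R t n))" for n
    using p[rule_format, of n] S by (simp_all add: f_def t_def case_prod_unfold)
  have f_le_t: "f m \<le> t n" if "m < n" for m n
    using that
  proof (induction n)
    case (Suc n)
    show ?case
    proof (cases "m = n")
      case True
      then show ?thesis using t(1)[of n] by (simp add: t(2))
    next
      case False
      then have "f m \<le> t n" using Suc by simp
      then show ?thesis using add_mono[OF _ f(2)[of n]] by (simp add: t(2))
    qed
  qed simp
  define c where "c k = (1 / 2 ^ k) *\<^sub>R f k" for k
  have c: "0 \<le> c k" for k using f(2) by (simp add: c_def scaleR_nonneg_nonneg)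
  have "summable c"
  proof (rule summable_comparison_test)
    show "summable (\<lambda>k. M * (1 / 2) ^ k)" by (intro summable_mult summable_geometric) simp
    show "\<exists>N. \<forall>n\<ge>N. norm (c n) \<le> M * (1 / 2) ^ n"
      using f(3) by (auto simp: c_def power_one_over divide_right_mono)
  qed
  then have c_le: "c k \<le> suminf c" for k by (rule term_le_suminf[OF _ c])
  define w where "w = suminf c"
  have w: "0 \<le> w" using c[of 0] c_le[of 0] by (simp add: w_def)
  define h where "h n = pprt (f n - 4 ^ n *\<^sub>R t n - (1 / 2 ^ n) *\<^sub>R w)" for n
  have parts: "0 \<le> 4 ^ n *\<^sub>R t n" "0 \<le> (1 / 2 ^ n) *\<^sub>R w" for n
    using t(1) w by (simp_all add: scaleR_nonneg_nonneg)
  have "h n \<le> f n" for n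
  proof -
    have "f n - 4 ^ n *\<^sub>R t n - (1 / 2 ^ n) *\<^sub>R w \<le> f n"
      using add_nonneg_nonneg[OF parts(2)[of n] parts(1)[of n]] by (simp add: diff_le_eq add.assoc)
    then show ?thesis using f(2) by (simp add: h_def pprt_def)
  qed
  moreover have "0 \<le> h n" for n by (simp add: h_def)
  moreover have disj: "inf (h m) (h n) = 0" if mn: "m < n" for m n
  proof (rule order.antisym)
    define a where "a = f n - 4 ^ n *\<^sub>R f m"
    have "4 ^ n *\<^sub>R f m \<le> 4 ^ n *\<^sub>R t n" by (intro scaleR_left_mono f_le_t mn) simp
    then have "f n - 4 ^ n *\<^sub>R t n - (1 / 2 ^ n) *\<^sub>R w \<le> a"
      using add_mono[OF _ parts(2)[of n]] by (simp add: a_def diff_le_eq algebra_simps)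
    then have h_n: "h n \<le> pprt a" unfolding h_def by (rule pprt_mono)
    have "(1 / 4 ^ n) *\<^sub>R f n \<le> (1 / 2 ^ m) *\<^sub>R c n"
    proof -
      have "(4::real) ^ n = 2 ^ n * 2 ^ n" by (simp flip: power_mult_distrib)
      moreover have "(2::real) ^ m * 2 ^ n \<le> 2 ^ n * 2 ^ n" using mn by simp
      ultimately have "1 / (4::real) ^ n \<le> 1 / 2 ^ m * (1 / 2 ^ n)"
        by (simp add: frac_le)
      then show ?thesis unfolding c_def scaleR_scaleR by (rule scaleR_right_mono) (rule f)
    qed
    also have "\<dots> \<le> (1 / 2 ^ m) *\<^sub>R w" unfolding w_def by (intro scaleR_left_mono c_le) simp
    finally have "f m - 4 ^ m *\<^sub>R t m - (1 / 2 ^ m) *\<^sub>R w \<le> f m - (1 / 4 ^ n) *\<^sub>R f n"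
      by (simp add: algebra_simps add_increasing parts(1))
    also have "\<dots> = (1 / 4 ^ n) *\<^sub>R (- a)"
      by (simp add: a_def scaleR_diff_right)
    also have "\<dots> \<le> (1 / 4 ^ n) *\<^sub>R pprt (- a)"
      by (intro scaleR_left_mono) (simp_all add: pprt_def)
    also have "\<dots> \<le> 1 *\<^sub>R pprt (- a)"
      by (intro scaleR_right_mono) (simp_all add: divide_le_eq)
    finally have "h m \<le> pprt (- a)" by (simp add: h_def pprt_def[of "_ - _ - _"])
    then have "inf (h m) (h n) \<le> inf (pprt (- a)) (pprt a)" using h_n by (rule inf_mono)
    then show "inf (h m) (h n) \<le> 0" using inf_pprt_pprt_minus[of a] by (simp add: inf_commute)
  qed (simp add: h_def)
  moreover have "inf (h m) (h n) = 0" if "m \<noteq> n" for m n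
    using disj[of m n] disj[of n m] that by (metis inf_commute nat_neq_iff)
  ultimately have "h \<longlonglongrightarrow> 0" by (intro null[of f h] f)
  moreover have "(\<lambda>n. (1 / 2 ^ n) *\<^sub>R w) \<longlonglongrightarrow> 0"
    using tendsto_scaleR[OF LIMSEQ_power_zero[of "1 / 2 :: real"] tendsto_const[of w]]
    by (simp add: power_one_over)
  ultimately have "(\<lambda>n. norm (h n) + norm ((1 / 2 ^ n) *\<^sub>R w)) \<longlonglongrightarrow> 0 + 0"
    by (intro tendsto_add tendsto_norm_zero)
  moreover have "e \<le> norm (h n) + norm ((1 / 2 ^ n) *\<^sub>R w)" for n
    using far[of n] norm_pprt_le_diff[OF parts(2)[of n], of "f n - 4 ^ n *\<^sub>R t n"]
    unfolding h_def by linarith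
  ultimately have "e \<le> 0 + 0"
    by (intro tendsto_lowerbound[OF _ always_eventually sequentially_bot]) auto
  then show False using e by simp
qed

section \<open>The dual positive Schur property\<close>

lemma weak_star_null_if_positive:
  fixes f :: "nat \<Rightarrow> 'a::banach_lattice \<Rightarrow>\<^sub>L real"
  assumes "\<And>x. 0 \<le> x \<Longrightarrow> (\<lambda>n. f n x) \<longlonglongrightarrow> 0"
  shows "limitin weak_star_topology f 0 sequentially"
  unfolding limitin_weak_star_topology
proof
  fix x :: 'a
  have "(\<lambda>n. f n (pprt x) - f n (- nprt x)) \<longlonglongrightarrow> 0 - 0"
    by (intro tendsto_diff assms) auto
  moreover have "f n (pprt x) - f n (- nprt x) = f n x" for n
    by (subst (3) prts[of x]) (simp only: blinfun.add_right blinfun.minus_right)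
  ultimately show "(\<lambda>n. f n x) \<longlonglongrightarrow> blinfun_apply 0 x" by simp
qed

text \<open>
  If \<open>\<bar>p n\<bar> u\<close> does not tend to \<open>0\<close>, the pieces \<open>z j\<close> of \<open>u\<close> on which \<open>\<bar>p (r j)\<bar>\<close> is large form a
  positive weak* null sequence in the dual, hence a norm null one, while the \<open>p n\<close> are bounded. Behind
  this is the fact that the dual has an order continuous norm.
\<close>

lemma dual_positive_schur_disjoint_bidual:
  fixes p :: "nat \<Rightarrow> ('e::banach_lattice \<Rightarrow>\<^sub>L real) \<Rightarrow>\<^sub>L real"
  assumes E: "dual_positive_schur TYPE('e)" and disj: "disjoint_sequence p"
    and bd: "\<And>n. norm (p n) \<le> C" and u: "0 \<le> u"
  shows "(\<lambda>n. \<bar>p n\<bar> u) \<longlonglongrightarrow> 0"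
proof (rule ccontr)
  assume "\<not> ?thesis"
  then obtain d where d: "0 < d" "infinite {n. d \<le> \<bar>p n\<bar> u}"
    using not_tendsto_0_infinite[of "\<lambda>n. \<bar>p n\<bar> u"] blinfun_nonneg[OF _ u] by force
  have "\<exists>(r :: nat \<Rightarrow> nat) z. strict_mono r \<and> (\<forall>j. 0 \<le> z j) \<and> (\<forall>j. sum z {..<j} \<le> u) \<and>
    (\<forall>j. d / 2 \<le> \<bar>p (r j)\<bar> (z j))"
    by (rule disjoint_functionals_witnesses[OF _ _ _ u d])
      (use disj bd in \<open>auto simp: norm_abs_eq disjoint_sequence_def\<close>)
  then obtain r :: "nat \<Rightarrow> nat" and z where "\<forall>j. 0 \<le> z j" "\<forall>j. sum z {..<j} \<le> u"
    "\<forall>j. d / 2 \<le> \<bar>p (r j)\<bar> (z j)" by (elim exE conjE) (rule that)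
  then have z: "\<And>j. 0 \<le> z j" "\<And>j. sum z {..<j} \<le> u" "\<And>j. d / 2 \<le> \<bar>p (r j)\<bar> (z j)"
    by blast+
  have "(\<lambda>j. z j x) \<longlonglongrightarrow> 0" if "0 \<le> x" for x
  proof (rule summable_LIMSEQ_zero[OF summableI_nonneg_bounded])
    show "0 \<le> z j x" for j using z(1) that by (rule blinfun_nonneg)
    show "(\<Sum>j<n. z j x) \<le> u x" for n
      using z(2)[of n] that by (simp add: less_eq_blinfun_def blinfun.sum_left)
  qed
  then have "z \<longlonglongrightarrow> 0"
    using E z(1) weak_star_null_if_positive unfolding dual_positive_schur_def by blast
  then have "(\<lambda>j. C * norm (z j)) \<longlonglongrightarrow> 0"
    by (intro tendsto_mult_right_zero tendsto_norm_zero)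
  moreover have "d / 2 \<le> C * norm (z j)" for j
  proof -
    have "\<bar>p (r j)\<bar> (z j) \<le> norm \<bar>p (r j)\<bar> * norm (z j)"
      using norm_blinfun[of "\<bar>p (r j)\<bar>" "z j"] by simp
    also have "\<dots> \<le> C * norm (z j)"
      unfolding norm_abs_eq by (intro mult_right_mono bd) simp
    finally show ?thesis using z(3)[of j] by linarith
  qed
  ultimately have "d / 2 \<le> 0"
    by (intro tendsto_lowerbound[OF _ always_eventually sequentially_bot]) auto
  then show False using d(1) by simp
qed

text \<open>
  The two hypotheses meet here: weak compactness makes disjoint functionals below the moduli
  \<open>\<bar>T\<^sup>* g\<bar>\<close> weak* null, and the dual positive Schur property makes them norm null.
\<close>

lemma adjoint_unit_ball_almost_order_bounded:
  fixes T :: "'e::banach_lattice \<Rightarrow>\<^sub>L 'x::banach"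
  assumes E: "dual_positive_schur TYPE('e)" and T: "order_weakly_compact T" and e: "0 < e"
  shows "\<exists>u\<ge>0. \<forall>g. norm g \<le> 1 \<longrightarrow> norm (pprt (\<bar>banach_adjoint T g\<bar> - u)) \<le> e"
proof -
  let ?S = "{\<bar>banach_adjoint T g\<bar> | g. norm g \<le> 1}"
  have "\<exists>u\<ge>0. \<forall>s\<in>?S. norm (pprt (s - u)) \<le> e"
  proof (rule almost_order_bounded_if_disjoint_null[OF _ _ _ e])
    show "0 \<le> s" if "s \<in> ?S" for s using that by auto
    show "norm s \<le> norm (banach_adjoint T)" if "s \<in> ?S" for s
    proof -
      from that obtain g where g: "s = \<bar>banach_adjoint T g\<bar>" "norm g \<le> 1" by blast
      have "norm s \<le> norm (banach_adjoint T) * norm g"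
        unfolding g(1) norm_abs_eq by (rule norm_blinfun)
      also have "\<dots> \<le> norm (banach_adjoint T)" using g(2) by (simp add: mult_left_le)
      finally show ?thesis .
    qed
    fix f h :: "nat \<Rightarrow> 'e \<Rightarrow>\<^sub>L real"
    assume f: "\<And>n. f n \<in> ?S" and h: "\<And>n. 0 \<le> h n" "\<And>n. h n \<le> f n"
      and disj: "\<And>m n. m \<noteq> n \<Longrightarrow> inf (h m) (h n) = 0"
    have "\<forall>n. \<exists>g. f n = \<bar>banach_adjoint T g\<bar> \<and> norm g \<le> 1" using f by blast
    then obtain g where g: "\<And>n. f n = \<bar>banach_adjoint T (g n)\<bar>" "\<And>n. norm (g n) \<le> 1"
      unfolding choice_iff by blast
    have "(\<lambda>n. h n x) \<longlonglongrightarrow> 0" if "0 \<le> x" for x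
      by (rule order_weakly_compact_disjoint_tendsto_0[OF T g(2) h(1) h(2)[unfolded g(1)] disj that])
    then show "h \<longlonglongrightarrow> 0"
      using E h(1) weak_star_null_if_positive unfolding dual_positive_schur_def by blast
  qed
  then show ?thesis by blast
qed

lemma biadjoint_disjoint_null:
  fixes T :: "'e::banach_lattice \<Rightarrow>\<^sub>L 'x::banach"
  assumes E: "dual_positive_schur TYPE('e)" and T: "order_weakly_compact T"
    and disj: "disjoint_sequence p" and bd: "\<And>n. norm (p n) \<le> C"
  shows "(\<lambda>n. banach_adjoint (banach_adjoint T) (p n)) \<longlonglongrightarrow> 0"
proof (rule tendstoI)
  fix e :: real assume e: "0 < e"
  have C: "0 \<le> C" using order_trans[OF norm_ge_zero bd] .
  define e' where "e' = e / (2 * (C + 1))"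
  have e': "0 < e'" "C * e' \<le> e / 2" using e C by (simp_all add: e'_def field_simps)
  obtain u where u: "0 \<le> u" "\<And>g. norm g \<le> 1 \<Longrightarrow> norm (pprt (\<bar>banach_adjoint T g\<bar> - u)) \<le> e'"
    using adjoint_unit_ball_almost_order_bounded[OF E T e'(1)] by blast
  have bound: "norm (banach_adjoint (banach_adjoint T) (p n)) \<le> (\<bar>p n\<bar> u + C * e') / 1" for n
  proof (rule norm_blinfun_le_on_ball)
    fix g :: "'x \<Rightarrow>\<^sub>L real" assume g: "norm g \<le> 1"
    let ?f = "\<bar>banach_adjoint T g\<bar>"
    have "\<bar>p n (banach_adjoint T g)\<bar> \<le> \<bar>p n\<bar> ?f" by (rule blinfun_abs_le)
    also have "\<dots> \<le> \<bar>p n\<bar> (u + pprt (?f - u))"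
      by (rule blinfun_mono) (simp_all add: pprt_def add_sup_distrib_left)
    also have "\<dots> \<le> \<bar>p n\<bar> u + C * e'"
    proof -
      have "\<bar>p n\<bar> (pprt (?f - u)) \<le> norm \<bar>p n\<bar> * norm (pprt (?f - u))"
        using norm_blinfun[of "\<bar>p n\<bar>" "pprt (?f - u)"] by simp
      also have "\<dots> \<le> C * e'" unfolding norm_abs_eq by (intro mult_mono bd u(2) g C) simp
      finally show ?thesis by (simp add: blinfun.add_right)
    qed
    finally show "norm (banach_adjoint (banach_adjoint T) (p n) g) \<le> \<bar>p n\<bar> u + C * e'"
      by (simp add: banach_adjoint_apply)
  qed simp
  have "eventually (\<lambda>n. \<bar>\<bar>p n\<bar> u\<bar> < e / 2) sequentially"
    using tendstoD[OF dual_positive_schur_disjoint_bidual[OF E disj bd u(1)], of "e / 2"] e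
    by (simp add: dist_real_def)
  then show "eventually (\<lambda>n. dist (banach_adjoint (banach_adjoint T) (p n)) 0 < e) sequentially"
  proof (rule eventually_mono)
    fix n assume "\<bar>\<bar>p n\<bar> u\<bar> < e / 2"
    then show "dist (banach_adjoint (banach_adjoint T) (p n)) 0 < e"
      using bound[of n] e'(2) by (simp add: dist_norm)
  qed
qed

theorem theorem4p4:
  fixes T :: "'e::banach_lattice \<Rightarrow>\<^sub>L 'x::banach"
  assumes "dual_positive_schur TYPE('e)"
    and "order_weakly_compact T"
  shows "almost_limited (banach_adjoint T) \<and>
         almost_dunford_pettis (banach_adjoint (banach_adjoint T))"
proof -
  have limited: "(\<lambda>n. banach_adjoint (banach_adjoint T) (p n)) \<longlonglongrightarrow> 0"
    if p: "disjoint_sequence p" and null: "limitin weak_star_topology p 0 sequentially" for p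
  proof -
    have "Bseq (\<lambda>n. p n f)" for f
      using null by (intro convergent_imp_Bseq convergentI) (auto simp: limitin_weak_star_topology)
    from uniform_boundedness[OF this] obtain C where "\<And>n. norm (p n) \<le> C" by blast
    then show ?thesis by (rule biadjoint_disjoint_null[OF assms p])
  qed
  have weak_star: "limitin weak_star_topology p 0 sequentially"
    if "limitin weak_topology p 0 sequentially" for p :: "nat \<Rightarrow> ('e \<Rightarrow>\<^sub>L real) \<Rightarrow>\<^sub>L real"
    unfolding limitin_weak_star_topology
  proof
    fix f :: "'e \<Rightarrow>\<^sub>L real"
    let ?ev = "Blinfun (\<lambda>q :: ('e \<Rightarrow>\<^sub>L real) \<Rightarrow>\<^sub>L real. q f)"
    have "?ev q = q f" for q
      by (simp add: bounded_linear_Blinfun_apply[OF blinfun.bounded_linear_left])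
    then show "(\<lambda>n. p n f) \<longlonglongrightarrow> blinfun_apply 0 f"
      using that[unfolded limitin_weak_topology, rule_format, of ?ev] by simp
  qed
  show ?thesis
    unfolding almost_limited_def almost_dunford_pettis_def
    using limited weak_star by blast
qed

end
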